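(* Let $(\Omega,\mathcal F,\mu)$ be a probability space and $1<p<\infty$. Then $$K_p:=\sup_{N\in\mathbb N}\big\|P_1:L^p(\Omega^N)\to L^p(\Omega^N)\big\|<\infty,$$ and for every $m\ge 1$, $$\sup_{N\in\mathbb N}\big\|P_m:L^p(\Omega^N)\to L^p(\Omega^N)\big\|\le \frac1{e}\,\big(e\,K_p\big)^m .$$
   Context: For $N\in\mathbb N$, $\Omega^N$ carries the product probability measure $\mu^{\otimes N}$, and $[1,N]=\{1,\dots,N\}$. For $A\subseteq[1,N]$, $\mathbb E_A$ is the conditional expectation onto the $\sigma$-algebra generated by the coordinates in $A$, i.e. $\mathbb E_Af(x)=\int f(x_A,y_{[1,N]\setminus A})\,d\mu^{\otimes([1,N]\setminus A)}(y)$; in particular $\mathbb E_\emptyset f=\mathbb E f$ is the mean. The Hoeffding projections are $P_A=\sum_{B\subseteq A}(-1)^{|A\setminus B|}\mathbb E_B$ (equivalently $P_A=(\mathrm{id}-\mathbb E)^{\otimes A}\otimes\mathbb E^{\otimes([1,N]\setminus A)}$), and $P_m=\sum_{A\subseteq[1,N],\,|A|=m}P_A$. These are mutually orthogonal orthogonal projections on $L^2(\Omega^N)$, and $P_m$ is the orthogonal projection onto the closed span of functions depending on at most $m$ coordinates intersected with the orthogonal complement of those depending on at most $m-1$ coordinates. *)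

theory Defs
  imports "HOL-Probability.Probability"
begin

definition cube :: "'a measure \<Rightarrow> nat \<Rightarrow> (nat \<Rightarrow> 'a) measure" where
  "cube M N = PiM {1..N} (\<lambda>_. M)"

definition cond_exp_coords ::
  "'a measure \<Rightarrow> nat \<Rightarrow> nat set \<Rightarrow> ((nat \<Rightarrow> 'a) \<Rightarrow> real) \<Rightarrow> (nat \<Rightarrow> 'a) \<Rightarrow> real" where
  "cond_exp_coords M N A f x =
     (\<integral>y. f (merge A ({1..N} - A) (x, y)) \<partial>(PiM ({1..N} - A) (\<lambda>_. M)))"

definition hoeffding_proj ::
  "'a measure \<Rightarrow> nat \<Rightarrow> nat set \<Rightarrow> ((nat \<Rightarrow> 'a) \<Rightarrow> real) \<Rightarrow> (nat \<Rightarrow> 'a) \<Rightarrow> real" where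
  "hoeffding_proj M N A f x = (\<Sum>B\<in>Pow A. (-1) ^ card (A - B) * cond_exp_coords M N B f x)"

definition hoeffding_level ::
  "'a measure \<Rightarrow> nat \<Rightarrow> nat \<Rightarrow> ((nat \<Rightarrow> 'a) \<Rightarrow> real) \<Rightarrow> (nat \<Rightarrow> 'a) \<Rightarrow> real" where
  "hoeffding_level M N m f x = (\<Sum>A\<in>{A. A \<subseteq> {1..N} \<and> card A = m}. hoeffding_proj M N A f x)"

definition in_Lp :: "'b measure \<Rightarrow> real \<Rightarrow> ('b \<Rightarrow> real) \<Rightarrow> bool" where
  "in_Lp M p f \<longleftrightarrow> f \<in> borel_measurable M \<and> integrable M (\<lambda>x. \<bar>f x\<bar> powr p)"

text \<open>Operator norm of T on L^p(M), valued in [0,\<infinity>]: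
  the infimum of all C \<ge> 0 with ||T f||_p \<le> C ||f||_p for all f in L^p,
  written with p-th powers: int |T f|^p \<le> C^p int |f|^p.\<close>
definition Lp_op_norm :: "'b measure \<Rightarrow> real \<Rightarrow> (('b \<Rightarrow> real) \<Rightarrow> ('b \<Rightarrow> real)) \<Rightarrow> ennreal" where
  "Lp_op_norm M p T = Inf {ennreal C | C. C \<ge> 0 \<and>
     (\<forall>f. in_Lp M p f \<longrightarrow>
        (\<integral>\<^sup>+ x. ennreal (\<bar>T f x\<bar> powr p) \<partial>M) \<le> ennreal (C powr p) * (\<integral>\<^sup>+ x. ennreal (\<bar>f x\<bar> powr p) \<partial>M))}"

end

theory Submission
  imports Defs
begin

text \<open>
  Write \<open>E\<^sub>A\<close> for the conditional expectation onto the coordinates in \<open>A\<close>, \<open>g\<^sub>k = E\<^sub>{\<^sub>k\<^sub>} f - E f\<close>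
  and \<open>P\<^sub>1 f = \<Sum> g\<^sub>k\<close>.

  \<^bold>\<open>Boundedness of \<open>P\<^sub>1\<close>.\<close> Let \<open>p \<ge> 2\<close>. Since \<open>g\<^sub>k\<close> is the image under \<open>E\<^sub>{\<^sub>k\<^sub>}\<close> of the \<open>k\<close>-th increment
  of the martingale \<open>k \<mapsto> E\<^sub>{\<^sub>1\<^sub>,\<^sub>\<dots>\<^sub>,\<^sub>k\<^sub>} f\<close>, uniform convexity of \<open>\<bar>x\<bar>\<^sup>p\<close> (a scalar Clarkson inequality) gives
  \<open>\<Sum> E \<bar>g\<^sub>k\<bar>\<^sup>p \<le> 2\<^sup>p\<^sup>-\<^sup>1 E \<bar>f\<bar>\<^sup>p\<close>, and likewise with \<open>2\<close> in place of \<open>p\<close>. The partial sums \<open>S\<^sub>k\<close> of the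
  independent centred \<open>g\<^sub>k\<close> satisfy
  \<open>E \<bar>S\<^sub>k\<bar>\<^sup>p \<le> E \<bar>S\<^sub>k\<^sub>-\<^sub>1\<bar>\<^sup>p + C (E \<bar>S\<^sub>k\<^sub>-\<^sub>1\<bar>\<^sup>p\<^sup>-\<^sup>2 E g\<^sub>k\<^sup>2 + E \<bar>g\<^sub>k\<bar>\<^sup>p)\<close>, so that a Gronwall argument bounds
  \<open>E \<bar>P\<^sub>1 f\<bar>\<^sup>p\<close> when \<open>E \<bar>f\<bar>\<^sup>p \<le> 1\<close>. The case \<open>p < 2\<close> follows by duality.

  \<^bold>\<open>From \<open>P\<^sub>1\<close> to \<open>P\<^sub>m\<close>.\<close> For a block \<open>B\<close> of coordinates, composing \<open>P\<^sub>1\<close> acting on \<open>B\<close> with \<open>P\<^sub>m\<close> acting on the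
  complement of \<open>B\<close> yields the sum of the Hoeffding projections over all \<open>A\<close> with \<open>\<bar>A \<inter> B\<bar> = 1\<close> and
  \<open>\<bar>A - B\<bar> = m\<close>. Averaging over random \<open>B\<close> containing each coordinate with probability \<open>1 / (m + 1)\<close>
  produces \<open>(1 - 1 / (m + 1))\<^sup>m P\<^sub>m\<^sub>+\<^sub>1\<close>, whence \<open>\<parallel>P\<^sub>m\<^sub>+\<^sub>1\<parallel> \<le> e \<parallel>P\<^sub>1\<parallel> \<parallel>P\<^sub>m\<parallel>\<close>.
\<close>

section \<open>Scalar inequalities\<close>

text \<open>Up to the factor \<open>p\<close>, \<open>signed_powr (p - 1)\<close> is the derivative
  of the p-th power of the modulus. It also sends L^p to the dual space L^q, which supplies the test
  functions for duality.\<close>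

definition signed_powr :: "real \<Rightarrow> real \<Rightarrow> real" where
  "signed_powr s a = sgn a * \<bar>a\<bar> powr s"

lemma abs_signed_powr: "\<bar>signed_powr s a\<bar> = \<bar>a\<bar> powr s"
  by (cases "a = 0") (auto simp: signed_powr_def abs_mult abs_sgn_eq)

lemma signed_powr_minus: "signed_powr s (- a) = - signed_powr s a"
  by (simp add: signed_powr_def sgn_minus)

lemma signed_powr_times_self: "signed_powr (p - 1) a * a = \<bar>a\<bar> powr p"
proof (cases "a = 0")
  case False
  have "signed_powr (p - 1) a * a = (sgn a * a) * \<bar>a\<bar> powr (p - 1)"
    by (simp add: signed_powr_def)
  also have "sgn a * a = \<bar>a\<bar>" by (simp add: sgn_if)
  also have "\<bar>a\<bar> * \<bar>a\<bar> powr (p - 1) = \<bar>a\<bar> powr p"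
    using False by (simp add: powr_mult_base)
  finally show ?thesis .
qed (simp add: signed_powr_def)

lemma borel_measurable_signed_powr [measurable]:
  "signed_powr s \<in> borel_measurable borel"
  unfolding signed_powr_def[abs_def] by measurable

text \<open>Young's inequality for \<open>a / l\<close> and \<open>l * b\<close>; the free parameter
  \<open>l\<close> later permits absorbing a term in the duality argument.\<close>

lemma abs_mult_le_Young:
  fixes a b l p q :: real
  assumes "1 < p" "q = p / (p - 1)" "0 < l"
  shows "\<bar>a * b\<bar> \<le> l powr (- p) * \<bar>a\<bar> powr p / p + l powr q * \<bar>b\<bar> powr q / q"
proof -
  have q: "q > 1" "1 / p + 1 / q = 1"
    using assms(1) unfolding assms(2) by (auto simp: divide_simps)
  have "(\<bar>a\<bar> / l) * (l * \<bar>b\<bar>) \<le> (\<bar>a\<bar> / l) powr p / p + (l * \<bar>b\<bar>) powr q / q"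
    by (rule Youngs_inequality) (use q assms in auto)
  moreover have "(\<bar>a\<bar> / l) powr p = l powr (- p) * \<bar>a\<bar> powr p"
    using assms by (simp add: powr_divide powr_minus_divide)
  moreover have "(l * \<bar>b\<bar>) powr q = l powr q * \<bar>b\<bar> powr q"
    using assms by (simp add: powr_mult)
  ultimately show ?thesis using assms by (simp add: abs_mult)
qed

text \<open>Convexity of the p-th power of the modulus, derived from Young's inequality for
  \<open>b\<close> and \<open>signed_powr (p - 1) a\<close>. Integrated or summed, it yields the
  forms of Jensen's inequality used below.\<close>

lemma abs_powr_tangent:
  fixes a b p :: real
  assumes "1 \<le> p"
  shows "\<bar>a\<bar> powr p + p * signed_powr (p - 1) a * (b - a) \<le> \<bar>b\<bar> powr p"
proof (cases "p = 1")
  case True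
  then show ?thesis by (auto simp: signed_powr_def sgn_if abs_if)
next
  case False
  with assms have p: "1 < p" by simp
  define q where "q = p / (p - 1)"
  have "signed_powr (p - 1) a * b \<le> \<bar>b * signed_powr (p - 1) a\<bar>" by (simp add: mult.commute)
  also have "\<dots> \<le> \<bar>b\<bar> powr p / p + \<bar>signed_powr (p - 1) a\<bar> powr q / q"
    using abs_mult_le_Young[OF p q_def, of 1 b "signed_powr (p - 1) a"] by simp
  also have "\<bar>signed_powr (p - 1) a\<bar> powr q = \<bar>a\<bar> powr p"
    using p by (simp add: abs_signed_powr powr_powr q_def)
  finally have "p * (signed_powr (p - 1) a * b) \<le> p * (\<bar>b\<bar> powr p / p + \<bar>a\<bar> powr p / q)"
    using p by (intro mult_left_mono) auto
  also have "\<dots> = \<bar>b\<bar> powr p + (p - 1) * \<bar>a\<bar> powr p"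
    using p by (simp add: q_def field_simps)
  finally show ?thesis
    using signed_powr_times_self[of p a] by (simp add: algebra_simps)
qed

lemma powr_add_superadditive:
  fixes u v s :: real
  assumes "0 \<le> u" "0 \<le> v" "1 \<le> s"
  shows "u powr s + v powr s \<le> (u + v) powr s"
proof -
  have *: "x powr s = x * x powr (s - 1)" if "x \<ge> 0" for x :: real
    using that by (cases "x = 0") (simp_all add: powr_mult_base)
  have "u powr s \<le> u * (u + v) powr (s - 1)" "v powr s \<le> v * (u + v) powr (s - 1)"
    using assms by (auto simp: * intro!: mult_left_mono powr_mono2)
  then show ?thesis using assms by (simp add: *[of "u + v"] algebra_simps)
qed

lemma powr_midpoint_convex:
  fixes u v s :: real
  assumes "0 \<le> u" "0 \<le> v" "1 \<le> s"
  shows "2 * ((u + v) / 2) powr s \<le> u powr s + v powr s"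
  using abs_powr_tangent[OF assms(3), of "(u + v) / 2" u]
    abs_powr_tangent[OF assms(3), of "(u + v) / 2" v] assms
  by (simp add: field_simps)

text \<open>The parallelogram identity, placed between superadditivity and midpoint convexity of the
  power \<open>p / 2\<close>, which is at least 1.\<close>

lemma abs_powr_Clarkson:
  fixes x y p :: real
  assumes "2 \<le> p"
  shows "2 * (\<bar>x\<bar> powr p + \<bar>y\<bar> powr p) \<le> \<bar>x + y\<bar> powr p + \<bar>x - y\<bar> powr p"
proof -
  have sq: "\<bar>z\<bar> powr p = (z\<^sup>2) powr (p / 2)" for z :: real
  proof -
    have "z\<^sup>2 = \<bar>z\<bar> powr 2" by (cases "z = 0") auto
    then have "(z\<^sup>2) powr (p / 2) = \<bar>z\<bar> powr (2 * (p / 2))" by (simp only: powr_powr)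
    then show ?thesis by simp
  qed
  have "2 * (\<bar>x\<bar> powr p + \<bar>y\<bar> powr p) \<le> 2 * (x\<^sup>2 + y\<^sup>2) powr (p / 2)"
    using powr_add_superadditive[of "x\<^sup>2" "y\<^sup>2" "p / 2"] assms by (simp add: sq)
  also have "x\<^sup>2 + y\<^sup>2 = ((x + y)\<^sup>2 + (x - y)\<^sup>2) / 2"
    by (simp add: power2_eq_square field_simps)
  also have "2 * \<dots> powr (p / 2) \<le> \<bar>x + y\<bar> powr p + \<bar>x - y\<bar> powr p"
    using powr_midpoint_convex[of "(x + y)\<^sup>2" "(x - y)\<^sup>2" "p / 2"] assms by (simp add: sq)
  finally show ?thesis .
qed

text \<open>Clarkson's inequality for \<open>a + b / 2\<close> and \<open>b / 2\<close>, whose sum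
  and difference are \<open>a + b\<close> and \<open>a\<close>, followed by the tangent at
  \<open>a\<close> evaluated at \<open>a + b / 2\<close>. The gain in \<open>b\<close> is what
  controls martingale increments.\<close>

lemma abs_powr_uniformly_convex:
  fixes a b p :: real
  assumes "2 \<le> p"
  shows "\<bar>a\<bar> powr p + p * signed_powr (p - 1) a * b + 2 powr (1 - p) * \<bar>b\<bar> powr p \<le> \<bar>a + b\<bar> powr p"
proof -
  have "\<bar>b / 2\<bar> powr p = 2 powr (- p) * \<bar>b\<bar> powr p"
    by (simp add: powr_divide powr_minus_divide)
  then have "2 * \<bar>b / 2\<bar> powr p = 2 powr (1 - p) * \<bar>b\<bar> powr p"
    by (simp add: powr_diff powr_minus_divide)
  then show ?thesis
    using abs_powr_Clarkson[OF assms, of "a + b / 2" "b / 2"]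
      abs_powr_tangent[of p a "a + b / 2"] assms
    by (simp add: algebra_simps)
qed

text \<open>A mean value estimate. By symmetry and oddness \<open>x\<close> may be taken positive
  and of larger modulus. If \<open>y\<close> is negative the two powers add up and
  \<open>1 \<le> p - 1\<close> supplies the constant; otherwise the tangent inequality with exponent
  \<open>p - 1\<close> applies.\<close>

lemma signed_powr_Lipschitz:
  fixes x y p :: real
  assumes "2 \<le> p"
  shows "\<bar>signed_powr (p - 1) x - signed_powr (p - 1) y\<bar>
    \<le> (p - 1) * \<bar>x - y\<bar> * max \<bar>x\<bar> \<bar>y\<bar> powr (p - 2)"
proof -
  have pos: "\<bar>signed_powr (p - 1) x - signed_powr (p - 1) y\<bar> \<le> (p - 1) * \<bar>x - y\<bar> * x powr (p - 2)"
    if "0 < x" "\<bar>y\<bar> \<le> x" for x y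
  proof (cases "y < 0")
    case True
    have "x powr (p - 1) = x * x powr (p - 2)" "(- y) powr (p - 1) = (- y) * (- y) powr (p - 2)"
      using that True powr_mult_base[of x "p - 2"] powr_mult_base[of "- y" "p - 2"] by simp_all
    moreover have "(- y) * (- y) powr (p - 2) \<le> (- y) * x powr (p - 2)"
      using that True assms by (intro mult_left_mono powr_mono2) auto
    ultimately have "x powr (p - 1) + (- y) powr (p - 1) \<le> (x - y) * x powr (p - 2)"
      by (simp add: algebra_simps)
    also have "\<dots> \<le> (p - 1) * (x - y) * x powr (p - 2)"
    proof (rule mult_right_mono)
      show "x - y \<le> (p - 1) * (x - y)"
        using mult_right_mono[of 1 "p - 1" "x - y"] assms that by auto
    qed simp
    finally show ?thesis using that True by (simp add: signed_powr_def)
  next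
    case False
    have "y powr (p - 1) \<le> x powr (p - 1)"
      using that False assms by (intro powr_mono2) auto
    moreover have "x powr (p - 1) + (p - 1) * x powr (p - 2) * (y - x) \<le> y powr (p - 1)"
      using abs_powr_tangent[of "p - 1" x y] that False assms by (simp add: signed_powr_def)
    moreover have "signed_powr (p - 1) y = y powr (p - 1)" "signed_powr (p - 1) x = x powr (p - 1)"
      using that False by (auto simp: signed_powr_def sgn_if)
    ultimately show ?thesis using that False by (simp add: algebra_simps)
  qed
  have gen: "\<bar>signed_powr (p - 1) x - signed_powr (p - 1) y\<bar> \<le> (p - 1) * \<bar>x - y\<bar> * \<bar>x\<bar> powr (p - 2)"
    if "\<bar>y\<bar> \<le> \<bar>x\<bar>" for x y
  proof -
    consider "x = 0" | "x > 0" | "x < 0" by linarith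
    then show ?thesis
    proof cases
      case 3
      have "\<bar>signed_powr (p - 1) (- x) - signed_powr (p - 1) (- y)\<bar> = \<bar>signed_powr (p - 1) x - signed_powr (p - 1) y\<bar>"
        "\<bar>- x - - y\<bar> = \<bar>x - y\<bar>" "\<bar>x\<bar> = - x"
        using 3 by (auto simp: signed_powr_minus)
      with pos[of "- x" "- y"] 3 that show ?thesis by simp
    qed (use pos that in \<open>auto simp: signed_powr_def\<close>)
  qed
  show ?thesis
  proof (cases "\<bar>y\<bar> \<le> \<bar>x\<bar>")
    case True
    then show ?thesis using gen[OF True] by (simp add: max_absorb1)
  next
    case False
    then show ?thesis using gen[of x y] by (simp add: max_absorb2 abs_minus_commute)
  qed
qed

text \<open>The tangent at \<open>a + b\<close>, evaluated at \<open>a\<close>, bounds the increment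
  from above with the derivative taken at \<open>a + b\<close>; \<open>signed_powr_Lipschitz\<close>
  pays for moving it to \<open>a\<close>. The remainder is split so that, for independent
  \<open>a\<close> and \<open>b\<close>, its expectation involves only separate moments of
  each.\<close>

lemma abs_powr_add_upper:
  fixes a b p :: real
  assumes "2 \<le> p"
  shows "\<bar>a + b\<bar> powr p \<le> \<bar>a\<bar> powr p + p * signed_powr (p - 1) a * b
    + p * (p - 1) * 2 powr (p - 2) * (\<bar>a\<bar> powr (p - 2) * b\<^sup>2 + \<bar>b\<bar> powr p)"
proof -
  have "\<bar>a + b\<bar> powr p - \<bar>a\<bar> powr p - p * signed_powr (p - 1) a * b
      \<le> p * ((signed_powr (p - 1) (a + b) - signed_powr (p - 1) a) * b)"
    using abs_powr_tangent[of p "a + b" a] assms by (simp add: algebra_simps)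
  also have "\<dots> \<le> p * (((p - 1) * \<bar>b\<bar> * max \<bar>a + b\<bar> \<bar>a\<bar> powr (p - 2)) * \<bar>b\<bar>)"
  proof (rule mult_left_mono)
    have "(signed_powr (p - 1) (a + b) - signed_powr (p - 1) a) * b
        \<le> \<bar>signed_powr (p - 1) (a + b) - signed_powr (p - 1) a\<bar> * \<bar>b\<bar>"
      by (metis abs_ge_self abs_mult)
    also have "\<dots> \<le> ((p - 1) * \<bar>b\<bar> * max \<bar>a + b\<bar> \<bar>a\<bar> powr (p - 2)) * \<bar>b\<bar>"
      using signed_powr_Lipschitz[OF assms, of "a + b" a] by (intro mult_right_mono) auto
    finally show "(signed_powr (p - 1) (a + b) - signed_powr (p - 1) a) * b \<le> \<dots>" .
  qed (use assms in simp)
  also have "\<dots> = p * (p - 1) * (max \<bar>a + b\<bar> \<bar>a\<bar> powr (p - 2) * b\<^sup>2)"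
    by (simp flip: abs_mult add: power2_eq_square mult.commute mult.left_commute)
  also have "\<dots> \<le> p * (p - 1) * (2 powr (p - 2) * (\<bar>a\<bar> powr (p - 2) * b\<^sup>2 + \<bar>b\<bar> powr p))"
  proof (rule mult_left_mono)
    have "max \<bar>a + b\<bar> \<bar>a\<bar> powr (p - 2) \<le> (2 * max \<bar>a\<bar> \<bar>b\<bar>) powr (p - 2)"
      using assms by (intro powr_mono2) auto
    also have "\<dots> = 2 powr (p - 2) * max \<bar>a\<bar> \<bar>b\<bar> powr (p - 2)"
      by (simp add: powr_mult)
    also have "\<dots> \<le> 2 powr (p - 2) * (\<bar>a\<bar> powr (p - 2) + \<bar>b\<bar> powr (p - 2))"
      by (intro mult_left_mono) (auto simp: max_def)
    finally have "max \<bar>a + b\<bar> \<bar>a\<bar> powr (p - 2) * b\<^sup>2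
        \<le> (2 powr (p - 2) * (\<bar>a\<bar> powr (p - 2) + \<bar>b\<bar> powr (p - 2))) * b\<^sup>2"
      by (intro mult_right_mono) auto
    moreover have "\<bar>b\<bar> powr (p - 2) * b\<^sup>2 = \<bar>b\<bar> powr p"
    proof (cases "b = 0")
      case False
      then have "b\<^sup>2 = \<bar>b\<bar> powr 2" by simp
      then have "\<bar>b\<bar> powr (p - 2) * b\<^sup>2 = \<bar>b\<bar> powr (p - 2 + 2)" by (simp only: powr_add)
      then show ?thesis by simp
    qed simp
    ultimately show "max \<bar>a + b\<bar> \<bar>a\<bar> powr (p - 2) * b\<^sup>2
        \<le> 2 powr (p - 2) * (\<bar>a\<bar> powr (p - 2) * b\<^sup>2 + \<bar>b\<bar> powr p)"
      by (simp add: mult.assoc distrib_right)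
  qed (use assms in simp)
  finally show ?thesis by (simp add: algebra_simps)
qed

lemma powr_le_one_add_powr:
  fixes x s p :: real
  assumes "0 \<le> s" "s \<le> p" "0 \<le> x"
  shows "x powr s \<le> 1 + x powr p"
proof (cases "x \<le> 1")
  case True
  then have "x powr s \<le> 1" using assms by (intro powr_le1) auto
  then show ?thesis by (simp add: add_increasing2)
next
  case False
  then have "x powr s \<le> x powr p" using assms by (intro powr_mono) auto
  then show ?thesis by simp
qed

lemma powr_add_le:
  fixes a b p :: real
  assumes "0 \<le> p"
  shows "\<bar>a + b\<bar> powr p \<le> 2 powr p * (\<bar>a\<bar> powr p + \<bar>b\<bar> powr p)"
proof -
  have "\<bar>a + b\<bar> powr p \<le> (2 * max \<bar>a\<bar> \<bar>b\<bar>) powr p"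
    using assms by (intro powr_mono2) auto
  also have "\<dots> = 2 powr p * max \<bar>a\<bar> \<bar>b\<bar> powr p" by (simp add: powr_mult)
  also have "\<dots> \<le> 2 powr p * (\<bar>a\<bar> powr p + \<bar>b\<bar> powr p)"
    by (intro mult_left_mono) (auto simp: max_def)
  finally show ?thesis .
qed

section \<open>Functions with integrable p-th power\<close>

lemma in_LpI_bound:
  fixes f g :: "'b \<Rightarrow> real"
  assumes "f \<in> borel_measurable M" "integrable M g" "AE x in M. \<bar>f x\<bar> powr p \<le> g x"
  shows "in_Lp M p f"
  unfolding in_Lp_def
proof (intro conjI)
  show "integrable M (\<lambda>x. \<bar>f x\<bar> powr p)"
  proof (rule Bochner_Integration.integrable_bound[OF assms(2)])
    show "AE x in M. norm (\<bar>f x\<bar> powr p) \<le> norm (g x)"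
      using assms(3) by eventually_elim auto
  qed (use assms(1) in measurable)
qed fact

lemma in_Lp_measurable [measurable_dest]: "in_Lp M p f \<Longrightarrow> f \<in> borel_measurable M"
  by (simp add: in_Lp_def)

lemma in_Lp_zero: "in_Lp M p (\<lambda>x. 0)"
  by (simp add: in_Lp_def)

lemma in_Lp_cmult:
  assumes "in_Lp M p f"
  shows "in_Lp M p (\<lambda>x. c * f x)"
  using assms by (auto simp: in_Lp_def abs_mult powr_mult)

lemma in_Lp_add:
  assumes f: "in_Lp M p f" and g: "in_Lp M p g" and "0 \<le> p"
  shows "in_Lp M p (\<lambda>x. f x + g x)"
  by (rule in_LpI_bound[where g="\<lambda>x. 2 powr p * (\<bar>f x\<bar> powr p + \<bar>g x\<bar> powr p)"])
    (use assms in \<open>auto simp: in_Lp_def intro!: powr_add_le\<close>)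

lemma in_Lp_diff:
  assumes "in_Lp M p f" "in_Lp M p g" "0 \<le> p"
  shows "in_Lp M p (\<lambda>x. f x - g x)"
  using in_Lp_add[OF assms(1) in_Lp_cmult[OF assms(2), of "-1"] assms(3)] by simp

lemma in_Lp_sum:
  assumes "\<And>i. i \<in> I \<Longrightarrow> in_Lp M p (f i)" "0 \<le> p"
  shows "in_Lp M p (\<lambda>x. \<Sum>i\<in>I. f i x)"
  using assms(1)
proof (induction I rule: infinite_finite_induct)
  case (insert i I)
  then show ?case using in_Lp_add[of M p "f i" "\<lambda>x. \<Sum>i\<in>I. f i x"] assms(2) by simp
qed (simp_all add: in_Lp_zero)

lemma integrable_Lp_mult:
  assumes "in_Lp M p f" "in_Lp M q g" "1 < p" "q = p / (p - 1)"
  shows "integrable M (\<lambda>x. f x * g x)"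
proof (rule Bochner_Integration.integrable_bound)
  show "integrable M (\<lambda>x. \<bar>f x\<bar> powr p / p + \<bar>g x\<bar> powr q / q)"
    using assms by (auto simp: in_Lp_def)
  show "AE x in M. norm (f x * g x) \<le> norm (\<bar>f x\<bar> powr p / p + \<bar>g x\<bar> powr q / q)"
    using abs_mult_le_Young[OF assms(3,4), of 1] by (intro AE_I2) (fastforce intro: order_trans)
qed (use assms in measurable)

lemma in_Lp_signed_powr:
  assumes "in_Lp M p f" "1 < p" "q = p / (p - 1)"
  shows "in_Lp M q (\<lambda>x. signed_powr (p - 1) (f x))"
  using assms by (auto simp: in_Lp_def abs_signed_powr powr_powr)

context prob_space
begin

lemma in_Lp_mono:
  assumes "in_Lp M p f" "0 \<le> s" "s \<le> p"
  shows "in_Lp M s f"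
  by (rule in_LpI_bound[where g="\<lambda>x. 1 + \<bar>f x\<bar> powr p"])
    (use assms in \<open>auto simp: in_Lp_def intro!: powr_le_one_add_powr\<close>)

lemma in_Lp_integrable:
  assumes "in_Lp M p f" "1 \<le> p"
  shows "integrable M f"
proof -
  have "integrable M (\<lambda>x. \<bar>f x\<bar> powr 1)"
    using in_Lp_mono[OF assms(1), of 1] assms(2) by (simp add: in_Lp_def)
  then have "integrable M (\<lambda>x. \<bar>f x\<bar>)" by (simp cong: Bochner_Integration.integrable_cong)
  then show ?thesis using assms(1) integrable_abs_cancel by (auto simp: in_Lp_def)
qed

text \<open>Jensen's inequality: the tangent inequality at the mean is integrated, and its linear
  term has mean zero.\<close>

lemma abs_expectation_powr_le:
  fixes h :: "'a \<Rightarrow> real" and p :: real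
  assumes "integrable M h" "integrable M (\<lambda>x. \<bar>h x\<bar> powr p)" "1 \<le> p"
  shows "\<bar>\<integral>x. h x \<partial>M\<bar> powr p \<le> (\<integral>x. \<bar>h x\<bar> powr p \<partial>M)"
proof -
  define c where "c = (\<integral>x. h x \<partial>M)"
  have "(\<integral>x. \<bar>c\<bar> powr p + p * signed_powr (p - 1) c * (h x - c) \<partial>M) \<le> (\<integral>x. \<bar>h x\<bar> powr p \<partial>M)"
    using assms by (intro integral_mono abs_powr_tangent) auto
  also have "(\<integral>x. \<bar>c\<bar> powr p + p * signed_powr (p - 1) c * (h x - c) \<partial>M) = \<bar>c\<bar> powr p"
    using assms(1) by (simp add: prob_space c_def)
  finally show ?thesis by (simp add: c_def)
qed

end

section \<open>Conditional expectations on the cube\<close>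

locale hoeffding_cube = prob_space M for M :: "'a measure" + fixes N :: nat
begin

definition coords :: "nat set" where
  "coords = {1..N}"

lemma finite_coords [simp]: "finite coords"
  by (simp add: coords_def)

abbreviation "P \<equiv> cube M N"
abbreviation "CE \<equiv> cond_exp_coords M N"

text \<open>Both arguments are points of the whole cube, so that every conditional expectation
  becomes an integral over the same space \<open>P\<close>, whatever \<open>A\<close> is.\<close>

definition glue :: "nat set \<Rightarrow> (nat \<Rightarrow> 'a) \<Rightarrow> (nat \<Rightarrow> 'a) \<Rightarrow> (nat \<Rightarrow> 'a)" where
  "glue A x y = merge A (coords - A) (x, y)"

definition depends_on :: "nat set \<Rightarrow> ((nat \<Rightarrow> 'a) \<Rightarrow> real) \<Rightarrow> bool" where
  "depends_on A u \<longleftrightarrow> (\<forall>x\<in>space P. \<forall>y\<in>space P. (\<forall>i\<in>A. x i = y i) \<longrightarrow> u x = u y)"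

sublocale cube: prob_space P
  unfolding cube_def by (rule prob_space_PiM) (rule prob_space_axioms)

sublocale PP: pair_prob_space P P
  by unfold_locales

lemma cube_eq_PiM: "P = PiM coords (\<lambda>_. M)"
  by (simp add: cube_def coords_def)

lemma space_cube: "space P = coords \<rightarrow>\<^sub>E space M"
  by (simp add: cube_eq_PiM space_PiM)

lemma glue_apply:
  "glue A x y i = (if i \<in> A then x i else if i \<in> coords then y i else undefined)"
  by (simp add: glue_def merge_def)

lemma glue_in_space:
  assumes "A \<subseteq> coords" "x \<in> space P" "y \<in> space P"
  shows "glue A x y \<in> space P"
  using assms by (auto simp: space_cube PiE_iff glue_apply extensional_def)

lemma measurable_glue:
  assumes "A \<subseteq> coords"
  shows "(\<lambda>z. glue A (fst z) (snd z)) \<in> P \<Otimes>\<^sub>M P \<rightarrow>\<^sub>M P"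
proof -
  have "(\<lambda>z. merge A (coords - A) (restrict (fst z) A, restrict (snd z) (coords - A)))
      \<in> P \<Otimes>\<^sub>M P \<rightarrow>\<^sub>M PiM (A \<union> (coords - A)) (\<lambda>_. M)"
    unfolding cube_eq_PiM
    by (intro measurable_compose[OF _ measurable_merge] measurable_Pair
          measurable_compose[OF measurable_fst] measurable_compose[OF measurable_snd]
          measurable_restrict_subset) (use assms in auto)
  moreover have "A \<union> (coords - A) = coords" using assms by auto
  ultimately show ?thesis by (simp add: glue_def cube_eq_PiM)
qed

lemma measurable_glue_right:
  assumes "A \<subseteq> coords" "x \<in> space P"
  shows "glue A x \<in> P \<rightarrow>\<^sub>M P"
  using measurable_compose[OF measurable_Pair1'[OF assms(2)] measurable_glue[OF assms(1)]] by simp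

lemma distr_restrict_cube:
  assumes "A \<subseteq> coords"
  shows "distr P (PiM A (\<lambda>_. M)) (\<lambda>x. restrict x A) = PiM A (\<lambda>_. M)"
proof -
  interpret product_prob_space "\<lambda>_. M" coords by unfold_locales
  show ?thesis
    unfolding cube_eq_PiM by (intro distr_PiM_restrict_finite) (use assms finite_subset[OF assms] in auto)
qed

text \<open>Splicing two independent samples of the cube gives a sample of the cube:
  \<open>P\<close> is the image under \<open>merge\<close> of its marginals on \<open>A\<close> and
  on the complement, and each marginal is the image of \<open>P\<close> under restriction. The
  Fubini arguments below rest on this.\<close>

lemma distr_glue:
  assumes A: "A \<subseteq> coords"
  shows "distr (P \<Otimes>\<^sub>M P) P (\<lambda>z. glue A (fst z) (snd z)) = P"
proof -
  let ?PA = "PiM A (\<lambda>_. M)" and ?PB = "PiM (coords - A) (\<lambda>_. M)"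
  have U: "A \<union> (coords - A) = coords" using assms by auto
  have fin: "finite A" using finite_subset[OF A] by simp
  interpret A: prob_space ?PA by (rule prob_space_PiM) (rule prob_space_axioms)
  interpret B: prob_space ?PB by (rule prob_space_PiM) (rule prob_space_axioms)
  interpret product_prob_space "\<lambda>_. M" coords by unfold_locales
  have mA: "(\<lambda>x. restrict x A) \<in> P \<rightarrow>\<^sub>M ?PA" and mB: "(\<lambda>x. restrict x (coords - A)) \<in> P \<rightarrow>\<^sub>M ?PB"
    unfolding cube_eq_PiM by (intro measurable_restrict_subset; use A in auto)+
  have "P = distr (?PA \<Otimes>\<^sub>M ?PB) P (merge A (coords - A))"
    using distr_merge[of A "coords - A"] fin U by (simp add: cube_eq_PiM)
  also have "?PA \<Otimes>\<^sub>M ?PB = distr P ?PA (\<lambda>x. restrict x A) \<Otimes>\<^sub>M distr P ?PB (\<lambda>x. restrict x (coords - A))"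
    using A by (simp add: distr_restrict_cube)
  also have "\<dots> = distr (P \<Otimes>\<^sub>M P) (?PA \<Otimes>\<^sub>M ?PB) (\<lambda>(x, y). (restrict x A, restrict y (coords - A)))"
    using A by (intro pair_measure_distr mA mB) (simp add: distr_restrict_cube B.sigma_finite_measure_axioms)
  also have "distr \<dots> P (merge A (coords - A)) =
      distr (P \<Otimes>\<^sub>M P) P (merge A (coords - A) \<circ> (\<lambda>(x, y). (restrict x A, restrict y (coords - A))))"
  proof (rule distr_distr)
    show "merge A (coords - A) \<in> ?PA \<Otimes>\<^sub>M ?PB \<rightarrow>\<^sub>M P"
      using measurable_merge[of A "coords - A" "\<lambda>_. M"] by (simp only: cube_eq_PiM U)
    show "(\<lambda>(x, y). (restrict x A, restrict y (coords - A))) \<in> P \<Otimes>\<^sub>M P \<rightarrow>\<^sub>M ?PA \<Otimes>\<^sub>M ?PB"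
      using mA mB by measurable
  qed
  also have "merge A (coords - A) \<circ> (\<lambda>(x, y). (restrict x A, restrict y (coords - A)))
      = (\<lambda>z. glue A (fst z) (snd z))"
    by (auto simp: fun_eq_iff glue_def)
  finally show ?thesis by simp
qed

text \<open>\<open>glue A x\<close> ignores the values of \<open>y\<close> on \<open>A\<close>, so
  integrating over all coordinates instead of the complement of \<open>A\<close> only adds variables
  of total mass one.\<close>

lemma cond_exp_eq_glue:
  assumes "A \<subseteq> coords" "x \<in> space P" "f \<in> borel_measurable P"
  shows "CE A f x = (\<integral>y. f (glue A x y) \<partial>P)"
proof -
  let ?PB = "PiM (coords - A) (\<lambda>_. M)"
  have U: "A \<union> (coords - A) = coords" using assms by auto
  have mB: "(\<lambda>x. restrict x (coords - A)) \<in> P \<rightarrow>\<^sub>M ?PB"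
    unfolding cube_eq_PiM by (intro measurable_restrict_subset) auto
  have xA: "restrict x A \<in> space (PiM A (\<lambda>_. M))"
    using assms by (auto simp: space_cube space_PiM PiE_iff)
  have m: "(\<lambda>y. merge A (coords - A) (x, y)) \<in> ?PB \<rightarrow>\<^sub>M P"
    using measurable_compose[OF measurable_Pair1'[OF xA] measurable_merge[of A "coords - A" "\<lambda>_. M"], unfolded U]
    by (simp add: cube_eq_PiM)
  have "CE A f x = (\<integral>y. f (merge A (coords - A) (x, y)) \<partial>distr P ?PB (\<lambda>x. restrict x (coords - A)))"
    by (simp add: cond_exp_coords_def distr_restrict_cube coords_def[symmetric] del: One_nat_def)
  also have "\<dots> = (\<integral>y. f (merge A (coords - A) (x, restrict y (coords - A))) \<partial>P)"
    by (intro integral_distr mB measurable_compose[OF m] assms)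
  finally show ?thesis by (simp add: glue_def)
qed

lemma measurable_comp_glue:
  assumes "A \<subseteq> coords" "f \<in> borel_measurable P"
  shows "(\<lambda>z. f (glue A (fst z) (snd z))) \<in> borel_measurable (P \<Otimes>\<^sub>M P)"
  by (rule measurable_compose[OF measurable_glue assms(2)]) fact

lemma integrable_comp_glue:
  fixes f :: "_ \<Rightarrow> real"
  assumes "A \<subseteq> coords" "integrable P f"
  shows "integrable (P \<Otimes>\<^sub>M P) (\<lambda>z. f (glue A (fst z) (snd z)))"
  using integrable_distr_eq[OF measurable_glue[OF assms(1)], of f] assms
  by (simp add: distr_glue)

lemma integral_comp_glue:
  fixes f :: "_ \<Rightarrow> real"
  assumes "A \<subseteq> coords" "f \<in> borel_measurable P"
  shows "(\<integral>z. f (glue A (fst z) (snd z)) \<partial>(P \<Otimes>\<^sub>M P)) = (\<integral>x. f x \<partial>P)"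
  using integral_distr[OF measurable_glue[OF assms(1)], of f] assms by (simp add: distr_glue)

lemma nn_integral_comp_glue:
  assumes "A \<subseteq> coords" "f \<in> borel_measurable P"
  shows "(\<integral>\<^sup>+x. \<integral>\<^sup>+y. f (glue A x y) \<partial>P \<partial>P) = (\<integral>\<^sup>+x. f x \<partial>P)"
proof -
  have m: "(\<lambda>z. f (glue A (fst z) (snd z))) \<in> borel_measurable (P \<Otimes>\<^sub>M P)"
    by (rule measurable_compose[OF measurable_glue]) fact+
  show ?thesis
    using cube.nn_integral_fst[OF m]
      nn_integral_distr[OF measurable_glue[OF assms(1)], of f] assms
    by (simp add: distr_glue)
qed

lemma borel_measurable_cond_exp:
  assumes "A \<subseteq> coords" "f \<in> borel_measurable P"
  shows "CE A f \<in> borel_measurable P"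
proof -
  have "(\<lambda>x. \<integral>y. f (glue A x y) \<partial>P) \<in> borel_measurable P"
    using measurable_comp_glue[OF assms]
    by (intro cube.borel_measurable_lebesgue_integral) (simp add: case_prod_unfold)
  then show ?thesis
    by (simp add: cond_exp_eq_glue assms cong: measurable_cong)
qed

lemma AE_integrable_glue:
  fixes f :: "_ \<Rightarrow> real"
  assumes "A \<subseteq> coords" "integrable P f"
  shows "AE x in P. integrable P (\<lambda>y. f (glue A x y))"
  using PP.AE_integrable_fst'[OF integrable_comp_glue[OF assms]] by simp

lemma integrable_cond_exp:
  assumes "A \<subseteq> coords" "integrable P f"
  shows "integrable P (CE A f)"
proof -
  have "integrable P (\<lambda>x. \<integral>y. f (glue A x y) \<partial>P)"
    using PP.integrable_fst'[OF integrable_comp_glue[OF assms]] by simp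
  then show ?thesis
    using assms by (simp add: cond_exp_eq_glue cong: Bochner_Integration.integrable_cong)
qed

lemma cond_exp_empty:
  assumes "f \<in> borel_measurable P" "x \<in> space P"
  shows "CE {} f x = (\<integral>y. f y \<partial>P)"
proof -
  have "glue {} x y = y" if "y \<in> space P" for y
    using that by (auto simp: fun_eq_iff glue_apply space_cube PiE_iff extensional_def)
  then show ?thesis using assms
    by (auto simp: cond_exp_eq_glue intro!: Bochner_Integration.integral_cong)
qed

lemma depends_on_mono: "depends_on A u \<Longrightarrow> A \<subseteq> B \<Longrightarrow> depends_on B u"
  unfolding depends_on_def by blast

lemma depends_on_comp:
  assumes "depends_on A u"
  shows "depends_on A (\<lambda>x. h (u x))"
  unfolding depends_on_def
proof (intro ballI impI)
  fix x y assume "x \<in> space P" "y \<in> space P" "\<forall>i\<in>A. x i = y i"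
  then have "u x = u y" using assms unfolding depends_on_def by blast
  then show "h (u x) = h (u y)" by simp
qed

lemma depends_on_sum:
  assumes "\<And>i. i \<in> J \<Longrightarrow> depends_on A (u i)"
  shows "depends_on A (\<lambda>x. \<Sum>i\<in>J. u i x)"
  unfolding depends_on_def
proof (intro ballI impI)
  fix x y assume "x \<in> space P" "y \<in> space P" "\<forall>i\<in>A. x i = y i"
  then have "u i x = u i y" if "i \<in> J" for i
    using assms[OF that] unfolding depends_on_def by blast
  then show "(\<Sum>i\<in>J. u i x) = (\<Sum>i\<in>J. u i y)" by simp
qed

lemma depends_on_cond_exp:
  assumes "A \<subseteq> coords" "f \<in> borel_measurable P"
  shows "depends_on A (CE A f)"
  unfolding depends_on_def
proof (intro ballI impI)
  fix x y assume *: "x \<in> space P" "y \<in> space P" "\<forall>i\<in>A. x i = y i"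
  then have "glue A x = glue A y" by (auto simp: fun_eq_iff glue_apply)
  with * assms show "CE A f x = CE A f y" by (simp add: cond_exp_eq_glue)
qed

lemma depends_on_glue:
  assumes "depends_on A u" "A \<subseteq> coords" "x \<in> space P" "y \<in> space P"
  shows "u (glue A x y) = u x"
  using assms(1)[unfolded depends_on_def, rule_format, OF glue_in_space[OF assms(2-4)] assms(3)]
  by (simp add: glue_apply)

lemma cond_exp_depends_on:
  assumes "depends_on A f" "A \<subseteq> coords" "f \<in> borel_measurable P" "x \<in> space P"
  shows "CE A f x = f x"
proof -
  have "CE A f x = (\<integral>y. f x \<partial>P)"
    unfolding cond_exp_eq_glue[OF assms(2,4,3)]
    by (intro Bochner_Integration.integral_cong) (auto simp: depends_on_glue assms)
  then show ?thesis by (simp add: cube.prob_space)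
qed

text \<open>Together with the tower property, this is the only form in which independence of the
  coordinates is needed.\<close>
lemma integral_depends_on_mult:
  assumes u: "depends_on A u" and A: "A \<subseteq> coords"
    and [measurable]: "h \<in> borel_measurable P" and int: "integrable P (\<lambda>x. u x * h x)"
  shows "(\<integral>x. u x * h x \<partial>P) = (\<integral>x. u x * CE A h x \<partial>P)"
proof -
  have "(\<integral>x. u x * h x \<partial>P) = (\<integral>z. u (glue A (fst z) (snd z)) * h (glue A (fst z) (snd z)) \<partial>(P \<Otimes>\<^sub>M P))"
    using integral_comp_glue[OF A, of "\<lambda>x. u x * h x"] int by simp
  also have "\<dots> = (\<integral>x. \<integral>y. u (glue A x y) * h (glue A x y) \<partial>P \<partial>P)"
    using PP.integral_fst'[OF integrable_comp_glue[OF A int]] by simp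
  also have "\<dots> = (\<integral>x. u x * CE A h x \<partial>P)"
  proof (intro Bochner_Integration.integral_cong refl)
    fix x assume x: "x \<in> space P"
    have "(\<integral>y. u (glue A x y) * h (glue A x y) \<partial>P) = (\<integral>y. u x * h (glue A x y) \<partial>P)"
      by (intro Bochner_Integration.integral_cong refl) (simp add: depends_on_glue u A x)
    then show "(\<integral>y. u (glue A x y) * h (glue A x y) \<partial>P) = u x * CE A h x"
      by (simp add: cond_exp_eq_glue A x)
  qed
  finally show ?thesis .
qed

text \<open>After gluing twice, only the coordinates in \<open>A \<inter> B\<close> still come from
  \<open>x\<close>; the others form a glued pair, again distributed by \<open>P\<close>. The claim
  is made almost everywhere because Fubini is applied to the section over \<open>x\<close>, which
  has to be integrable.\<close>

lemma cond_exp_tower: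
  assumes A: "A \<subseteq> coords" and B: "B \<subseteq> coords" and f: "integrable P f"
  shows "AE x in P. CE A (CE B f) x = CE (A \<inter> B) f x"
proof -
  have [measurable]: "f \<in> borel_measurable P" using f by auto
  have AB: "A \<inter> B \<subseteq> coords" using A by auto
  have "AE x in P. integrable P (\<lambda>y. f (glue (A \<inter> B) x y))"
    by (rule AE_integrable_glue[OF AB f])
  with AE_space show ?thesis
  proof eventually_elim
    case (elim x)
    have eq: "glue B (glue A x y) z = glue (A \<inter> B) x (glue B y z)" for y z
      using B by (auto simp: fun_eq_iff glue_apply)
    have "CE A (CE B f) x = (\<integral>y. (\<integral>z. f (glue B (glue A x y) z) \<partial>P) \<partial>P)"
      unfolding cond_exp_eq_glue[OF A elim(1) borel_measurable_cond_exp[OF B \<open>f \<in> _\<close>]]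
      by (intro Bochner_Integration.integral_cong refl cond_exp_eq_glue)
        (auto simp: B glue_in_space A elim)
    also have "\<dots> = (\<integral>y. (\<integral>z. f (glue (A \<inter> B) x (glue B y z)) \<partial>P) \<partial>P)"
      by (simp add: eq)
    also have "\<dots> = (\<integral>w. f (glue (A \<inter> B) x (glue B (fst w) (snd w))) \<partial>(P \<Otimes>\<^sub>M P))"
      using PP.integral_fst'[OF integrable_comp_glue[OF B elim(2)]] by simp
    also have "\<dots> = (\<integral>y. f (glue (A \<inter> B) x y) \<partial>P)"
      using integral_comp_glue[OF B, of "\<lambda>y. f (glue (A \<inter> B) x y)"] elim by simp
    also have "\<dots> = CE (A \<inter> B) f x"
      using elim AB by (simp add: cond_exp_eq_glue)
    finally show ?case .
  qed
qed

abbreviation "mom p f \<equiv> (\<integral>x. \<bar>f x\<bar> powr p \<partial>P)"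

lemma integral_cond_exp:
  assumes "A \<subseteq> coords" "integrable P f"
  shows "(\<integral>x. CE A f x \<partial>P) = (\<integral>x. f x \<partial>P)"
  using integral_depends_on_mult[of A "\<lambda>_. 1" f] assms by (auto simp: depends_on_def)

lemma cond_exp_cong_space:
  assumes "\<And>x. x \<in> space P \<Longrightarrow> f x = g x" "A \<subseteq> coords" "x \<in> space P"
    "f \<in> borel_measurable P" "g \<in> borel_measurable P"
  shows "CE A f x = CE A g x"
  unfolding cond_exp_eq_glue[OF assms(2,3,4)] cond_exp_eq_glue[OF assms(2,3,5)]
  by (intro Bochner_Integration.integral_cong refl assms(1) glue_in_space assms(2,3))

lemma cond_exp_sum:
  assumes A: "A \<subseteq> coords" and "finite J" and f: "\<And>j. j \<in> J \<Longrightarrow> integrable P (f j)"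
  shows "AE x in P. CE A (\<lambda>x. \<Sum>j\<in>J. c j * f j x) x = (\<Sum>j\<in>J. c j * CE A (f j) x)"
proof -
  have "AE x in P. \<forall>j\<in>J. integrable P (\<lambda>y. f j (glue A x y))"
    using assms by (intro AE_finite_allI AE_integrable_glue) auto
  with AE_space show ?thesis
  proof eventually_elim
    case (elim x)
    have [measurable]: "\<And>j. j \<in> J \<Longrightarrow> f j \<in> borel_measurable P" using f by auto
    have "CE A (\<lambda>x. \<Sum>j\<in>J. c j * f j x) x = (\<integral>y. (\<Sum>j\<in>J. c j * f j (glue A x y)) \<partial>P)"
      using elim A by (intro cond_exp_eq_glue) auto
    also have "\<dots> = (\<Sum>j\<in>J. c j * (\<integral>y. f j (glue A x y) \<partial>P))"
      using elim by (subst Bochner_Integration.integral_sum) auto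
    also have "\<dots> = (\<Sum>j\<in>J. c j * CE A (f j) x)"
      using elim A by (intro sum.cong refl) (simp add: cond_exp_eq_glue)
    finally show ?case .
  qed
qed

lemma cond_exp_diff:
  assumes A: "A \<subseteq> coords" and f: "integrable P f" and g: "integrable P g"
  shows "AE x in P. CE A (\<lambda>x. f x - g x) x = CE A f x - CE A g x"
  using cond_exp_sum[OF A, of "{True, False}" "\<lambda>b. if b then f else g" "\<lambda>b. if b then 1 else -1"] f g
  by simp

lemma cond_exp_Lp:
  assumes A: "A \<subseteq> coords" and f: "in_Lp P p f" and p: "1 \<le> p"
  shows in_Lp_cond_exp: "in_Lp P p (CE A f)" and mom_cond_exp_le: "mom p (CE A f) \<le> mom p f"
proof -
  have [measurable]: "f \<in> borel_measurable P" using f by measurable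
  have i: "integrable P f" by (rule cube.in_Lp_integrable[OF f p])
  have ip: "integrable P (\<lambda>x. \<bar>f x\<bar> powr p)" using f by (simp add: in_Lp_def)
  have le: "AE x in P. \<bar>CE A f x\<bar> powr p \<le> CE A (\<lambda>x. \<bar>f x\<bar> powr p) x"
    using AE_integrable_glue[OF A i] AE_integrable_glue[OF A ip] AE_space
  proof eventually_elim
    case (elim x)
    then show ?case using cube.abs_expectation_powr_le[OF elim(1,2) p] A
      by (simp add: cond_exp_eq_glue)
  qed
  have "CE A f \<in> borel_measurable P" using A by (simp add: borel_measurable_cond_exp)
  then show *: "in_Lp P p (CE A f)" by (rule in_LpI_bound[OF _ integrable_cond_exp[OF A ip] le])
  have "mom p (CE A f) \<le> (\<integral>x. CE A (\<lambda>x. \<bar>f x\<bar> powr p) x \<partial>P)"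
    using * by (intro integral_mono_AE le integrable_cond_exp[OF A ip]) (simp add: in_Lp_def)
  then show "mom p (CE A f) \<le> mom p f" by (simp add: integral_cond_exp[OF A ip])
qed

lemma cond_exp_depends_on_disjoint:
  assumes A: "A \<subseteq> coords" and B: "B \<subseteq> coords" "A \<inter> B = {}" and h: "depends_on B h" "integrable P h"
  shows "AE x in P. CE A h x = (\<integral>y. h y \<partial>P)"
  using cond_exp_tower[OF A B(1) h(2)] AE_space
proof eventually_elim
  case (elim x)
  have [measurable]: "h \<in> borel_measurable P" using h by auto
  have "CE A h x = CE A (CE B h) x"
    using A B h elim by (intro cond_exp_cong_space) (auto simp: cond_exp_depends_on borel_measurable_cond_exp)
  then show ?case using elim B by (simp add: cond_exp_empty)
qed

text \<open>Independence: conditioning the second factor on the coordinates of the first turns it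
  into a constant.\<close>

lemma integral_mult_depends_on_disjoint:
  assumes "A \<subseteq> coords" "B \<subseteq> coords" "A \<inter> B = {}" "depends_on A u" "depends_on B h"
    and [measurable]: "u \<in> borel_measurable P"
    and h: "integrable P h" and "integrable P (\<lambda>x. u x * h x)"
  shows "(\<integral>x. u x * h x \<partial>P) = (\<integral>x. u x \<partial>P) * (\<integral>x. h x \<partial>P)"
proof -
  have [measurable]: "h \<in> borel_measurable P" "CE A h \<in> borel_measurable P"
    using assms by (auto intro: borel_measurable_cond_exp)
  have "(\<integral>x. u x * h x \<partial>P) = (\<integral>x. u x * CE A h x \<partial>P)"
    by (rule integral_depends_on_mult) (use assms in auto)
  also have "\<dots> = (\<integral>x. u x * (\<integral>y. h y \<partial>P) \<partial>P)"
  proof (intro integral_cong_AE)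
    show "AE x in P. u x * CE A h x = u x * (\<integral>y. h y \<partial>P)"
      using cond_exp_depends_on_disjoint[OF assms(1-3,5) h] by eventually_elim simp
  qed measurable
  finally show ?thesis by simp
qed

section \<open>The first level\<close>

definition comp1 :: "((nat \<Rightarrow> 'a) \<Rightarrow> real) \<Rightarrow> nat \<Rightarrow> (nat \<Rightarrow> 'a) \<Rightarrow> real" where
  "comp1 f i x = CE {i} f x - CE {} f x"

lemma hoeffding_level_1: "hoeffding_level M N 1 f = (\<lambda>x. \<Sum>i\<in>coords. comp1 f i x)"
proof
  fix x
  have "{A. A \<subseteq> coords \<and> card A = 1} = (\<lambda>i. {i}) ` coords"
    by (auto simp: card_1_singleton_iff)
  then have "hoeffding_level M N 1 f x = (\<Sum>i\<in>coords. hoeffding_proj M N {i} f x)"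
    unfolding hoeffding_level_def coords_def[symmetric] by (simp add: sum.reindex)
  also have "\<dots> = (\<Sum>i\<in>coords. comp1 f i x)"
  proof (intro sum.cong refl)
    fix i :: nat
    have "Pow {i} = {{}, {i}}" by auto
    then show "hoeffding_proj M N {i} f x = comp1 f i x"
      by (simp add: hoeffding_proj_def comp1_def)
  qed
  finally show "hoeffding_level M N 1 f x = (\<Sum>i\<in>coords. comp1 f i x)" .
qed

lemma depends_on_comp1:
  assumes "i \<in> coords" "f \<in> borel_measurable P"
  shows "depends_on {i} (comp1 f i)"
  using depends_on_cond_exp[of "{i}" f] depends_on_mono[OF depends_on_cond_exp[of "{}" f], of "{i}"] assms
  unfolding depends_on_def comp1_def by (metis empty_subsetI insert_subset)

lemma in_Lp_comp1:
  assumes "i \<in> coords" "in_Lp P p f" "1 \<le> p"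
  shows "in_Lp P p (comp1 f i)"
  unfolding comp1_def[abs_def] using assms by (intro in_Lp_diff in_Lp_cond_exp) auto

lemma integral_comp1:
  assumes "i \<in> coords" "integrable P f"
  shows "(\<integral>x. comp1 f i x \<partial>P) = 0"
  using assms by (simp add: comp1_def integrable_cond_exp integral_cond_exp)

text \<open>The increments of the martingale \<open>CE {1..k} f\<close> are mapped to the functions
  \<open>comp1 f k\<close> by the contractions \<open>CE {k}\<close>, and by uniform convexity the moments of
  the martingale grow at least by the moments of the increments.\<close>
lemma sum_mom_comp1_le:
  assumes f: "in_Lp P p f" and p: "2 \<le> p"
  shows "(\<Sum>i\<in>coords. mom p (comp1 f i)) \<le> 2 powr (p - 1) * mom p f"
proof -
  have [measurable]: "f \<in> borel_measurable P" using f by measurable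
  have i: "integrable P f" using f p by (intro cube.in_Lp_integrable[OF f]) auto
  define F where "F k = CE {1..k} f" for k
  have F: "in_Lp P p (F k)" "integrable P (F k)" if "k \<le> N" for k
    using that f p i by (auto simp: F_def coords_def intro!: in_Lp_cond_exp integrable_cond_exp)
  have step: "2 powr (1 - p) * mom p (comp1 f (Suc k)) \<le> mom p (F (Suc k)) - mom p (F k)" if k: "k < N" for k
  proof -
    have sub: "{1..k} \<subseteq> coords" "{1..Suc k} \<subseteq> coords" "{Suc k} \<subseteq> coords"
      using k by (auto simp: coords_def)
    define d where "d x = F (Suc k) x - F k x" for x
    note Fk = F[of k] F[of "Suc k"]
    have d: "in_Lp P p d" "integrable P d"
      unfolding d_def[abs_def] using Fk p k by (auto intro!: in_Lp_diff)
    have [measurable]: "d \<in> borel_measurable P" "F k \<in> borel_measurable P" using d Fk k by auto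
    have "AE x in P. CE {Suc k} d x = comp1 f (Suc k) x"
    proof -
      have "{Suc k} \<inter> {1..Suc k} = {Suc k}" "{Suc k} \<inter> {1..k} = {}" by auto
      then show ?thesis
        using cond_exp_diff[OF sub(3) Fk(4) Fk(2)] k cond_exp_tower[OF sub(3) sub(2) i]
          cond_exp_tower[OF sub(3) sub(1) i]
        by (auto simp: F_def d_def[abs_def] comp1_def elim!: eventually_elim2)
    qed
    moreover have [measurable]: "CE {Suc k} d \<in> borel_measurable P" "comp1 f (Suc k) \<in> borel_measurable P"
      using sub f p by (auto intro!: borel_measurable_cond_exp in_Lp_measurable[OF in_Lp_comp1])
    ultimately have "mom p (comp1 f (Suc k)) = mom p (CE {Suc k} d)"
      by (intro integral_cong_AE) auto
    also have "\<dots> \<le> mom p d" using d p by (intro mom_cond_exp_le sub) auto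
    finally have le: "2 powr (1 - p) * mom p (comp1 f (Suc k)) \<le> 2 powr (1 - p) * mom p d"
      by (rule mult_left_mono) simp
    \<comment> \<open>Up to the factor \<open>p\<close>, \<open>u\<close> is the derivative of the
      p-th power at \<open>F k\<close>. It depends on the first \<open>k\<close> coordinates only,
      and \<open>d\<close> has conditional mean zero given these, so the linear term of uniform
      convexity integrates to zero.\<close>
    define u where "u x = signed_powr (p - 1) (F k x)" for x
    have [measurable]: "u \<in> borel_measurable P" unfolding u_def[abs_def] by measurable
    have ud: "integrable P (\<lambda>x. d x * u x)"
      unfolding u_def using d Fk k p by (intro integrable_Lp_mult[OF d(1)] in_Lp_signed_powr) auto
    have "depends_on {1..k} (F k)"
      unfolding F_def by (intro depends_on_cond_exp sub) simp
    then have dep: "depends_on {1..k} u" unfolding u_def[abs_def] by (rule depends_on_comp)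
    have "(\<integral>x. u x * d x \<partial>P) = (\<integral>x. u x * CE {1..k} d x \<partial>P)"
      using ud by (intro integral_depends_on_mult dep sub) (simp_all add: mult.commute)
    also have "\<dots> = (\<integral>x. 0 \<partial>P)"
    proof (intro integral_cong_AE)
      have "{1..k} \<inter> {1..Suc k} = {1..k}" by auto
      then show "AE x in P. u x * CE {1..k} d x = 0"
        using cond_exp_diff[OF sub(1) Fk(4) Fk(2)] k cond_exp_tower[OF sub(1) sub(2) i]
          cond_exp_tower[OF sub(1) sub(1) i]
        by (auto simp: F_def d_def[abs_def] elim!: eventually_elim2)
    qed (use sub in \<open>auto intro!: borel_measurable_times borel_measurable_cond_exp\<close>)
    finally have ud0: "(\<integral>x. u x * d x \<partial>P) = 0" by simp
    have "mom p (F k) + p * (\<integral>x. u x * d x \<partial>P) + 2 powr (1 - p) * mom p d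
        = (\<integral>x. \<bar>F k x\<bar> powr p + p * (u x * d x) + 2 powr (1 - p) * \<bar>d x\<bar> powr p \<partial>P)"
      using Fk d ud k by (simp add: in_Lp_def mult.commute[of "u _"])
    also have "\<dots> \<le> (\<integral>x. \<bar>F (Suc k) x\<bar> powr p \<partial>P)"
    proof (intro integral_mono)
      show "\<bar>F k x\<bar> powr p + p * (u x * d x) + 2 powr (1 - p) * \<bar>d x\<bar> powr p \<le> \<bar>F (Suc k) x\<bar> powr p" for x
        using abs_powr_uniformly_convex[OF p, of "F k x" "d x"] by (simp add: u_def d_def mult.assoc)
    qed (use Fk d ud k in \<open>auto simp: in_Lp_def mult.commute[of "u _"]\<close>)
    finally show ?thesis using le unfolding ud0 by linarith
  qed
  have "2 powr (1 - p) * (\<Sum>i\<in>coords. mom p (comp1 f i))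
      = (\<Sum>k<N. 2 powr (1 - p) * mom p (comp1 f (Suc k)))"
    by (simp add: sum_distrib_left coords_def sum.atLeast1_atMost_eq)
  also have "\<dots> \<le> (\<Sum>k<N. mom p (F (Suc k)) - mom p (F k))"
    using step by (intro sum_mono) auto
  also have "\<dots> = mom p (F N) - mom p (F 0)" by (rule sum_lessThan_telescope)
  also have "\<dots> \<le> mom p (F N)" by simp
  also have "\<dots> \<le> mom p f" unfolding F_def using f p by (intro mom_cond_exp_le) (auto simp: coords_def)
  finally have "2 powr (p - 1) * (2 powr (1 - p) * (\<Sum>i\<in>coords. mom p (comp1 f i))) \<le> 2 powr (p - 1) * mom p f"
    by (intro mult_left_mono) auto
  moreover have "2 powr (p - 1) * 2 powr (1 - p) = (1::real)" by (simp flip: powr_add)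
  ultimately show ?thesis by (simp flip: mult.assoc)
qed

end

text \<open>The Gronwall bound. Here \<open>p * (p - 1) * 2 powr (p - 2)\<close> is the remainder
  constant of \<open>abs_powr_add_upper\<close>, and \<open>4 + 2 powr (p - 1)\<close> bounds the
  total of the second and p-th moments of all \<open>comp1 f i\<close> when \<open>mom p f\<close>
  is at most 1.\<close>

definition level1_const :: "real \<Rightarrow> real" where
  "level1_const p = exp (p * (p - 1) * 2 powr (p - 2) * (4 + 2 powr (p - 1)))"

context hoeffding_cube
begin

text \<open>One Gronwall step, obtained by integrating \<open>abs_powr_add_upper\<close>. The linear
  term vanishes because the new summand is centred and independent of \<open>S k\<close>, and the
  mixed remainder factorises. Adding 1 to the moments makes the recursion multiplicative, since the
  moment of order \<open>p - 2\<close> is at most 1 plus that of order \<open>p\<close>.\<close>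

lemma mom_sum_comp1_le:
  assumes f: "in_Lp P p f" and p: "2 \<le> p" and k: "k < N"
  defines "S \<equiv> \<lambda>k x. \<Sum>i = 1..k. comp1 f i x"
  shows "mom p (S (Suc k)) + 1 \<le>
    (1 + p * (p - 1) * 2 powr (p - 2) * (mom 2 (comp1 f (Suc k)) + mom p (comp1 f (Suc k)))) * (mom p (S k) + 1)"
proof -
  define C where "C = p * (p - 1) * 2 powr (p - 2)"
  have C: "0 \<le> C" using p by (simp add: C_def)
  have [measurable]: "f \<in> borel_measurable P" using f by measurable
  have i: "integrable P f" using f p by (intro cube.in_Lp_integrable[OF f]) auto
  have sub: "{1..k} \<subseteq> coords" "{Suc k} \<subseteq> coords" "{1..k} \<inter> {Suc k} = {}"
    using k by (auto simp: coords_def)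
  have S: "in_Lp P p (S k)" "in_Lp P p (S (Suc k))"
    unfolding S_def using f p k by (intro in_Lp_sum in_Lp_comp1; simp add: coords_def)+
  define g where "g = comp1 f (Suc k)"
  have g: "in_Lp P p g" unfolding g_def using f p sub by (auto intro!: in_Lp_comp1)
  have g1: "integrable P g" using p by (intro cube.in_Lp_integrable[OF g]) auto
  have g2: "in_Lp P 2 g" using p by (intro cube.in_Lp_mono[OF g]) auto
  have Ss: "integrable P (\<lambda>x. \<bar>S k x\<bar> powr (p - 2))"
    using cube.in_Lp_mono[OF S(1), of "p - 2"] p by (simp add: in_Lp_def)
  have [measurable]: "S k \<in> borel_measurable P" "g \<in> borel_measurable P" using S g by auto
  have "depends_on {1..k} (comp1 f i)" if "i \<in> {1..k}" for i
    using that sub(1) by (intro depends_on_mono[OF depends_on_comp1]) auto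
  then have dS: "depends_on {1..k} (S k)"
    unfolding S_def by (rule depends_on_sum)
  have dg: "depends_on {Suc k} g" unfolding g_def using sub by (intro depends_on_comp1) auto
  define u where "u x = signed_powr (p - 1) (S k x)" for x
  have [measurable]: "u \<in> borel_measurable P" unfolding u_def[abs_def] by measurable
  have du: "depends_on {1..k} u" unfolding u_def[abs_def] by (rule depends_on_comp[OF dS])
  have "integrable P (\<lambda>x. g x * u x)"
    unfolding u_def using S p by (intro integrable_Lp_mult[OF g] in_Lp_signed_powr) auto
  then have ug: "integrable P (\<lambda>x. u x * g x)" by (simp add: mult.commute)
  have "(\<integral>x. u x * g x \<partial>P) = (\<integral>x. u x \<partial>P) * (\<integral>x. g x \<partial>P)"
    by (rule integral_mult_depends_on_disjoint[OF sub du dg _ g1 ug]) simp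
  also have "(\<integral>x. g x \<partial>P) = 0" unfolding g_def using sub i by (intro integral_comp1) auto
  finally have ug0: "(\<integral>x. u x * g x \<partial>P) = 0" by simp
  have sg: "integrable P (\<lambda>x. \<bar>S k x\<bar> powr (p - 2) * (g x)\<^sup>2)"
  proof (rule Bochner_Integration.integrable_bound)
    show "integrable P (\<lambda>x. \<bar>S k x\<bar> powr p + \<bar>g x\<bar> powr p)" using S g by (simp add: in_Lp_def)
    show "AE x in P. norm (\<bar>S k x\<bar> powr (p - 2) * (g x)\<^sup>2) \<le> norm (\<bar>S k x\<bar> powr p + \<bar>g x\<bar> powr p)"
    proof (intro AE_I2)
      fix x
      define m where "m = max \<bar>S k x\<bar> \<bar>g x\<bar>"
      have "\<bar>S k x\<bar> powr (p - 2) * (g x)\<^sup>2 \<le> m powr (p - 2) * m\<^sup>2"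
        using p by (intro mult_mono powr_mono2) (auto simp: m_def abs_le_square_iff[symmetric])
      also have "\<dots> = m powr p"
      proof (cases "m = 0")
        case False
        then have "m\<^sup>2 = m powr 2" by (simp add: m_def)
        then have "m powr (p - 2) * m\<^sup>2 = m powr (p - 2 + 2)" by (simp only: powr_add)
        then show ?thesis by simp
      qed simp
      also have "\<dots> \<le> \<bar>S k x\<bar> powr p + \<bar>g x\<bar> powr p" by (auto simp: m_def max_def)
      finally show "norm (\<bar>S k x\<bar> powr (p - 2) * (g x)\<^sup>2) \<le> norm (\<bar>S k x\<bar> powr p + \<bar>g x\<bar> powr p)" by simp
    qed
  qed measurable
  have "(\<integral>x. \<bar>S k x\<bar> powr (p - 2) * (g x)\<^sup>2 \<partial>P) = mom (p - 2) (S k) * (\<integral>x. (g x)\<^sup>2 \<partial>P)"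
    by (rule integral_mult_depends_on_disjoint[OF sub depends_on_comp[OF dS] depends_on_comp[OF dg] _ _ sg])
      (use g2 in \<open>auto simp: in_Lp_def\<close>)
  also have "(\<integral>x. (g x)\<^sup>2 \<partial>P) = mom 2 g" by simp
  also have "mom (p - 2) (S k) * mom 2 g \<le> (1 + mom p (S k)) * mom 2 g"
  proof (rule mult_right_mono)
    have "mom (p - 2) (S k) \<le> (\<integral>x. 1 + \<bar>S k x\<bar> powr p \<partial>P)"
      using p Ss S by (intro integral_mono powr_le_one_add_powr) (auto simp: in_Lp_def)
    also have "\<dots> = 1 + mom p (S k)" using S by (simp add: in_Lp_def cube.prob_space)
    finally show "mom (p - 2) (S k) \<le> 1 + mom p (S k)" .
  qed simp
  finally have le: "(\<integral>x. \<bar>S k x\<bar> powr (p - 2) * (g x)\<^sup>2 \<partial>P) \<le> (1 + mom p (S k)) * mom 2 g" .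
  have "mom p (S (Suc k)) \<le> (\<integral>x. \<bar>S k x\<bar> powr p + p * (u x * g x)
      + C * (\<bar>S k x\<bar> powr (p - 2) * (g x)\<^sup>2 + \<bar>g x\<bar> powr p) \<partial>P)"
  proof (intro integral_mono)
    show "\<bar>S (Suc k) x\<bar> powr p \<le> \<bar>S k x\<bar> powr p + p * (u x * g x)
      + C * (\<bar>S k x\<bar> powr (p - 2) * (g x)\<^sup>2 + \<bar>g x\<bar> powr p)" for x
      using abs_powr_add_upper[OF p, of "S k x" "g x"]
      by (simp add: S_def g_def u_def C_def mult.assoc)
  qed (use S g sg ug in \<open>auto simp: in_Lp_def\<close>)
  also have "\<dots> = mom p (S k) + C * ((\<integral>x. \<bar>S k x\<bar> powr (p - 2) * (g x)\<^sup>2 \<partial>P) + mom p g)"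
    using S g sg ug by (simp add: in_Lp_def ug0)
  also have "\<dots> \<le> mom p (S k) + C * ((1 + mom p (S k)) * mom 2 g + (1 + mom p (S k)) * mom p g)"
  proof (intro add_left_mono mult_left_mono add_mono le C)
    \<comment> \<open>Weakened on purpose, so that both remainder terms carry the factor
      \<open>1 + mom p (S k)\<close>.\<close>
    show "mom p g \<le> (1 + mom p (S k)) * mom p g"
      using mult_right_mono[of 1 "1 + mom p (S k)" "mom p g"] by simp
  qed
  finally show ?thesis unfolding g_def C_def[symmetric] by (simp add: algebra_simps)
qed

text \<open>The steps are multiplied up using \<open>1 + x \<le> exp x\<close>. Normalising
  \<open>mom p f\<close> allows the second moments, which scale differently from the p-th ones, to
  be bounded by a constant.\<close>

lemma mom_level1_le_const:
  assumes f: "in_Lp P p f" and p: "2 \<le> p" and f1: "mom p f \<le> 1"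
  shows "mom p (hoeffding_level M N 1 f) \<le> level1_const p"
proof -
  define C where "C = p * (p - 1) * 2 powr (p - 2)"
  have C: "0 \<le> C" using p by (simp add: C_def)
  define S where "S k x = (\<Sum>i = 1..k. comp1 f i x)" for k x
  define ab where "ab i = mom 2 (comp1 f i) + mom p (comp1 f i)" for i
  have ab: "0 \<le> ab i" for i by (simp add: ab_def)
  have "mom p (S k) + 1 \<le> exp (C * (\<Sum>i=1..k. ab i))" if "k \<le> N" for k
    using that
  proof (induction k)
    case (Suc k)
    have "mom p (S (Suc k)) + 1 \<le> (1 + C * ab (Suc k)) * (mom p (S k) + 1)"
      using mom_sum_comp1_le[OF f p, of k] Suc.prems by (simp add: S_def[abs_def] C_def ab_def)
    also have "\<dots> \<le> exp (C * ab (Suc k)) * exp (C * (\<Sum>i=1..k. ab i))"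
      using Suc C ab by (intro mult_mono exp_ge_add_one_self) auto
    also have "\<dots> = exp (C * (\<Sum>i=1..Suc k. ab i))"
      by (simp add: exp_add[symmetric] algebra_simps)
    finally show ?case .
  qed (simp add: S_def)
  then have "mom p (S N) + 1 \<le> exp (C * (\<Sum>i=1..N. ab i))" by simp
  also have "\<dots> \<le> exp (C * (4 + 2 powr (p - 1)))"
  proof -
    have f2: "in_Lp P 2 f" using p by (intro cube.in_Lp_mono[OF f]) auto
    have "mom 2 f \<le> (\<integral>x. 1 + \<bar>f x\<bar> powr p \<partial>P)"
      using p f f2 by (intro integral_mono powr_le_one_add_powr) (auto simp: in_Lp_def simp del: powr_numeral)
    also have "\<dots> \<le> 2" using f f1 by (simp add: in_Lp_def cube.prob_space)
    finally have m2: "mom 2 f \<le> 2" .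
    have "(\<Sum>i=1..N. ab i) = (\<Sum>i\<in>coords. mom 2 (comp1 f i)) + (\<Sum>i\<in>coords. mom p (comp1 f i))"
      by (simp add: ab_def coords_def sum.distrib)
    also have "\<dots> \<le> 2 powr (2 - 1) * mom 2 f + 2 powr (p - 1) * mom p f"
      using f f2 p by (intro add_mono sum_mom_comp1_le) auto
    also have "\<dots> \<le> 2 * 2 + 2 powr (p - 1) * 1"
      using m2 f1 by (intro add_mono mult_mono) auto
    finally show ?thesis using C by (auto intro!: mult_left_mono)
  qed
  also have "S N = hoeffding_level M N 1 f"
    unfolding hoeffding_level_1 by (simp add: fun_eq_iff S_def coords_def)
  finally show ?thesis by (simp add: level1_const_def C_def)
qed

lemma cond_exp_cmult: "CE A (\<lambda>x. c * f x) x = c * CE A f x"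
  by (simp add: cond_exp_coords_def)

text \<open>Homogeneity: the normalised bound is applied to multiples \<open>l * f\<close>. If
  \<open>mom p f\<close> vanishes, every positive \<open>l\<close> is admissible, which forces the
  left side to vanish.\<close>

lemma mom_level1_le_ge2:
  assumes f: "in_Lp P p f" and p: "2 \<le> p"
  shows "mom p (hoeffding_level M N 1 f) \<le> level1_const p * mom p f"
proof -
  have scaled: "l powr p * mom p (hoeffding_level M N 1 f) \<le> level1_const p"
    if l: "0 < l" "l powr p * mom p f \<le> 1" for l
  proof -
    have "hoeffding_level M N 1 (\<lambda>x. l * f x) = (\<lambda>x. l * hoeffding_level M N 1 f x)"
      unfolding hoeffding_level_1
      by (simp add: comp1_def cond_exp_cmult sum_distrib_left right_diff_distrib)
    then show ?thesis
      using mom_level1_le_const[OF in_Lp_cmult[OF f, of l] p] l by (simp add: abs_mult powr_mult)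
  qed
  show ?thesis
  proof (cases "mom p f = 0")
    case True
    have "mom p (hoeffding_level M N 1 f) \<le> 0"
    proof (rule ccontr)
      assume "\<not> ?thesis"
      then have X: "0 < mom p (hoeffding_level M N 1 f)" by simp
      \<comment> \<open>Chosen so that \<open>t\<close> times the moment equals
        \<open>level1_const p + 1\<close>, which exceeds the bound.\<close>
      define t where "t = (level1_const p + 1) / mom p (hoeffding_level M N 1 f)"
      have t: "0 < t" using X by (simp add: t_def level1_const_def add_pos_pos)
      have "(t powr (1 / p)) powr p = t" using t p by (simp add: powr_powr)
      then have "t * mom p (hoeffding_level M N 1 f) \<le> level1_const p"
        using scaled[of "t powr (1 / p)"] True t by simp
      then show False using X by (simp add: t_def)
    qed
    then show ?thesis using True by simp
  next
    case False
    then have Y: "0 < mom p f" by (simp add: less_le)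
    have "(mom p f powr (- 1 / p)) powr p = mom p f powr (- 1)"
      unfolding powr_powr using p by simp
    also have "\<dots> = 1 / mom p f" using Y by (simp add: powr_minus_divide)
    finally have "(mom p f powr (- 1 / p)) powr p = 1 / mom p f" .
    then have "mom p (hoeffding_level M N 1 f) / mom p f \<le> level1_const p"
      using scaled[of "mom p f powr (- 1 / p)"] Y by simp
    then show ?thesis using Y by (simp add: field_simps)
  qed
qed

section \<open>Duality and exponents below 2\<close>

lemma in_Lp_level1:
  assumes "in_Lp P p f" "1 \<le> p"
  shows "in_Lp P p (hoeffding_level M N 1 f)"
  unfolding hoeffding_level_1 using assms by (intro in_Lp_sum in_Lp_comp1) auto

text \<open>Both sides equal the integral of \<open>CE A f * CE A v\<close>, by conditioning the
  factor that is not yet a conditional expectation.\<close>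

lemma cond_exp_selfadjoint:
  assumes f: "in_Lp P p f" and v: "in_Lp P q v" and p: "1 < p" "q = p / (p - 1)" and A: "A \<subseteq> coords"
  shows "(\<integral>x. CE A f x * v x \<partial>P) = (\<integral>x. f x * CE A v x \<partial>P)"
proof -
  have q: "1 < q" using p(1) unfolding p(2) by (simp add: divide_simps)
  have Ef: "in_Lp P p (CE A f)" and Ev: "in_Lp P q (CE A v)"
    using f v p q by (auto intro!: in_Lp_cond_exp[OF A])
  have "(\<integral>x. CE A f x * v x \<partial>P) = (\<integral>x. CE A f x * CE A v x \<partial>P)"
    using f v p A by (intro integral_depends_on_mult depends_on_cond_exp integrable_Lp_mult[OF Ef v p]) auto
  moreover have "(\<integral>x. CE A v x * f x \<partial>P) = (\<integral>x. CE A v x * CE A f x \<partial>P)"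
    using f v p A integrable_Lp_mult[OF f Ev p]
    by (intro integral_depends_on_mult depends_on_cond_exp) (auto simp: mult.commute)
  ultimately show ?thesis by (simp add: mult.commute)
qed

lemma level1_selfadjoint:
  assumes f: "in_Lp P p f" and v: "in_Lp P q v" and p: "1 < p" "q = p / (p - 1)"
  shows "(\<integral>x. hoeffding_level M N 1 f x * v x \<partial>P) = (\<integral>x. f x * hoeffding_level M N 1 v x \<partial>P)"
proof -
  have q: "1 < q" using p(1) unfolding p(2) by (simp add: divide_simps)
  have *: "integrable P (\<lambda>x. CE A f x * v x)" "integrable P (\<lambda>x. f x * CE A v x)" if "A \<subseteq> coords" for A
    using integrable_Lp_mult[OF in_Lp_cond_exp[OF that f] v p]
      integrable_Lp_mult[OF f in_Lp_cond_exp[OF that v] p] q p(1) by auto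
  have "(\<integral>x. hoeffding_level M N 1 f x * v x \<partial>P)
      = (\<Sum>i\<in>coords. (\<integral>x. CE {i} f x * v x \<partial>P) - (\<integral>x. CE {} f x * v x \<partial>P))"
    unfolding hoeffding_level_1 sum_distrib_right comp1_def left_diff_distrib
    using * by (simp add: Bochner_Integration.integral_sum)
  also have "\<dots> = (\<Sum>i\<in>coords. (\<integral>x. f x * CE {i} v x \<partial>P) - (\<integral>x. f x * CE {} v x \<partial>P))"
    using cond_exp_selfadjoint[OF f v p] by (intro sum.cong) auto
  also have "\<dots> = (\<integral>x. f x * hoeffding_level M N 1 v x \<partial>P)"
    unfolding hoeffding_level_1 sum_distrib_left comp1_def right_diff_distrib
    using * by (simp add: Bochner_Integration.integral_sum)
  finally show ?thesis .
qed

text \<open>Duality in Young's form: test \<open>S = P\<^sub>1 f\<close> against \<open>v = sgn S \<bar>S\<bar>\<^sup>p\<^sup>-\<^sup>1\<close>, and choose the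
  free parameter of Young's inequality such that half of \<open>E\<bar>S\<bar>\<^sup>p\<close> can be absorbed.\<close>
lemma mom_level1_le_less2:
  assumes f: "in_Lp P p f" and p: "1 < p" "p < 2" and q: "q = p / (p - 1)"
  defines "l \<equiv> (q / (2 * level1_const q)) powr (1 / q)"
  shows "mom p (hoeffding_level M N 1 f) \<le> 2 * l powr (- p) / p * mom p f"
proof -
  have q2: "2 \<le> q" using p by (simp add: q field_simps)
  have C: "0 < level1_const q" by (simp add: level1_const_def)
  have l: "0 < l" using C q2 by (simp add: l_def)
  \<comment> \<open>With this value, \<open>l powr q * level1_const q / q\<close> equals
    1/2.\<close>
  have lq: "l powr q = q / (2 * level1_const q)"
    using C q2 by (simp add: l_def powr_powr)
  define S where "S = hoeffding_level M N 1 f"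
  define v where "v x = signed_powr (p - 1) (S x)" for x
  have S: "in_Lp P p S" unfolding S_def using f p by (intro in_Lp_level1) auto
  have v: "in_Lp P q v" unfolding v_def[abs_def] using S p q by (intro in_Lp_signed_powr)
  have Tv: "in_Lp P q (hoeffding_level M N 1 v)" using v q2 by (intro in_Lp_level1) auto
  have vq: "\<bar>v x\<bar> powr q = \<bar>S x\<bar> powr p" for x
    using p by (simp add: v_def abs_signed_powr powr_powr q)
  have "mom p S = (\<integral>x. S x * v x \<partial>P)"
    by (simp add: v_def mult.commute[of "S _"] signed_powr_times_self)
  also have "\<dots> = (\<integral>x. f x * hoeffding_level M N 1 v x \<partial>P)"
    unfolding S_def by (rule level1_selfadjoint[OF f v p(1) q])
  also have "\<dots> \<le> (\<integral>x. l powr (- p) * \<bar>f x\<bar> powr p / p + l powr q * \<bar>hoeffding_level M N 1 v x\<bar> powr q / q \<partial>P)"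
    using f v Tv integrable_Lp_mult[OF f Tv p(1) q] abs_mult_le_Young[OF p(1) q l]
    by (intro integral_mono) (auto simp: in_Lp_def intro: order_trans[OF abs_ge_self])
  also have "\<dots> = l powr (- p) * mom p f / p + l powr q * mom q (hoeffding_level M N 1 v) / q"
    using f Tv by (simp add: in_Lp_def)
  also have "l powr q * mom q (hoeffding_level M N 1 v) / q \<le> l powr q * (level1_const q * mom q v) / q"
    using mom_level1_le_ge2[OF v q2] q2 by (intro divide_right_mono mult_left_mono) auto
  also have "\<dots> = mom p S / 2" using C q2 by (simp add: vq lq)
  finally show ?thesis unfolding S_def[symmetric] by (simp add: field_simps)
qed

end

lemma level1_bounded:
  assumes "prob_space M" "1 < p"
  obtains C where "0 \<le> C" "\<And>N f. in_Lp (cube M N) p f \<Longrightarrow>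
    (\<integral>x. \<bar>hoeffding_level M N 1 f x\<bar> powr p \<partial>cube M N) \<le> C * (\<integral>x. \<bar>f x\<bar> powr p \<partial>cube M N)"
proof (cases "2 \<le> p")
  case True
  show ?thesis
  proof (rule that)
    show "0 \<le> level1_const p" by (simp add: level1_const_def)
  next
    fix N f
    assume *: "in_Lp (cube M N) p f"
    interpret hoeffding_cube M N using assms by (simp add: hoeffding_cube_def)
    show "mom p (hoeffding_level M N 1 f) \<le> level1_const p * mom p f"
      by (rule mom_level1_le_ge2[OF * True])
  qed
next
  case False
  define q where "q = p / (p - 1)"
  show ?thesis
  proof (rule that)
    show "0 \<le> 2 * ((q / (2 * level1_const q)) powr (1 / q)) powr (- p) / p" using assms by simp
  next
    fix N f
    assume *: "in_Lp (cube M N) p f"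
    interpret hoeffding_cube M N using assms by (simp add: hoeffding_cube_def)
    show "mom p (hoeffding_level M N 1 f)
        \<le> 2 * ((q / (2 * level1_const q)) powr (1 / q)) powr (- p) / p * mom p f"
      using mom_level1_le_less2[OF * assms(2) _ q_def] False by simp
  qed
qed

section \<open>Higher levels\<close>

text \<open>Sets containing \<open>i\<close> pair off with those that do not, with opposite signs.
  For conditional expectations this kills every Hoeffding projection whose set \<open>A\<close>
  contains a coordinate that the function ignores.\<close>

lemma sum_Pow_alternating_eq_0:
  fixes h :: "'b set \<Rightarrow> real"
  assumes "finite A" "i \<in> A" "\<And>S. S \<subseteq> A - {i} \<Longrightarrow> h (insert i S) = h S"
  shows "(\<Sum>S\<in>Pow A. (-1) ^ card (A - S) * h S) = 0"
proof -
  define A' where "A' = A - {i}"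
  have A: "A = insert i A'" "i \<notin> A'" "finite A'" using assms by (auto simp: A'_def)
  have inj: "inj_on (insert i) (Pow A')" using A by (auto simp: inj_on_def)
  have "(\<Sum>S\<in>Pow A. (-1) ^ card (A - S) * h S)
      = (\<Sum>S\<in>Pow A'. (-1) ^ card (A - S) * h S) + (\<Sum>S\<in>insert i ` Pow A'. (-1) ^ card (A - S) * h S)"
    unfolding A(1) Pow_insert using A by (intro sum.union_disjoint) auto
  also have "(\<Sum>S\<in>insert i ` Pow A'. (-1) ^ card (A - S) * h S)
      = (\<Sum>S\<in>Pow A'. (-1) ^ card (A - insert i S) * h (insert i S))"
    by (simp add: sum.reindex[OF inj])
  also have "\<dots> = (\<Sum>S\<in>Pow A'. - ((-1) ^ card (A - S) * h S))"
  proof (intro sum.cong refl)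
    fix S assume S: "S \<in> Pow A'"
    have "A - insert i S = A' - S" "A - S = insert i (A' - S)" using A S by auto
    then have "card (A - S) = Suc (card (A - insert i S))" using A by simp
    moreover have "h (insert i S) = h S" using assms(3)[of S] S by (simp add: A'_def)
    ultimately show "(-1) ^ card (A - insert i S) * h (insert i S) = - ((-1) ^ card (A - S) * h S)" by simp
  qed
  finally show ?thesis by (simp add: sum_negf)
qed

text \<open>The signs are multiplicative over a disjoint union. This is the combinatorial form of
  the product rule for Hoeffding projections on disjoint coordinate sets.\<close>

lemma sum_Pow_alternating_Un:
  fixes h :: "'b set \<Rightarrow> real"
  assumes "finite A" "finite B" "A \<inter> B = {}"
  shows "(\<Sum>S\<in>Pow (A \<union> B). (-1) ^ card (A \<union> B - S) * h S)
    = (\<Sum>S\<in>Pow A. \<Sum>T\<in>Pow B. (-1) ^ card (A - S) * ((-1) ^ card (B - T) * h (S \<union> T)))"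
proof -
  have "(\<Sum>S\<in>Pow A. \<Sum>T\<in>Pow B. (-1) ^ card (A - S) * ((-1) ^ card (B - T) * h (S \<union> T)))
      = (\<Sum>(S, T)\<in>Pow A \<times> Pow B. (-1) ^ card (A - S) * ((-1) ^ card (B - T) * h (S \<union> T)))"
    by (rule sum.cartesian_product)
  also have "\<dots> = (\<Sum>S\<in>Pow (A \<union> B). (-1) ^ card (A \<union> B - S) * h S)"
  proof (rule sum.reindex_bij_witness[where i="\<lambda>S. (S \<inter> A, S \<inter> B)" and j="\<lambda>(S, T). S \<union> T"])
    fix z assume z: "z \<in> Pow A \<times> Pow B"
    then obtain S T where zST: "z = (S, T)" and ST: "S \<subseteq> A" "T \<subseteq> B" by auto
    have "A \<union> B - (S \<union> T) = (A - S) \<union> (B - T)" using ST assms by auto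
    moreover have "card ((A - S) \<union> (B - T)) = card (A - S) + card (B - T)"
      using assms by (intro card_Un_disjoint) auto
    ultimately show "(-1) ^ card (A \<union> B - (case z of (S, T) \<Rightarrow> S \<union> T)) * h (case z of (S, T) \<Rightarrow> S \<union> T)
        = (case z of (S, T) \<Rightarrow> (-1) ^ card (A - S) * ((-1) ^ card (B - T) * h (S \<union> T)))"
      by (simp add: zST power_add)
  qed (use assms in auto)
  finally show ?thesis by simp
qed

lemma sum_subsets_split:
  fixes H :: "'b set \<Rightarrow> real"
  assumes "finite I" "B \<subseteq> I"
  shows "(\<Sum>A1\<in>{A. A \<subseteq> B \<and> card A = j}. \<Sum>A2\<in>{A. A \<subseteq> I - B \<and> card A = k}. H (A1 \<union> A2))
    = (\<Sum>A\<in>{A. A \<subseteq> I \<and> card (A \<inter> B) = j \<and> card (A - B) = k}. H A)"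
proof -
  have "(\<Sum>A1\<in>{A. A \<subseteq> B \<and> card A = j}. \<Sum>A2\<in>{A. A \<subseteq> I - B \<and> card A = k}. H (A1 \<union> A2))
      = (\<Sum>(A1, A2)\<in>{A. A \<subseteq> B \<and> card A = j} \<times> {A. A \<subseteq> I - B \<and> card A = k}. H (A1 \<union> A2))"
    by (rule sum.cartesian_product)
  also have "\<dots> = (\<Sum>A\<in>{A. A \<subseteq> I \<and> card (A \<inter> B) = j \<and> card (A - B) = k}. H A)"
  proof (rule sum.reindex_bij_witness[where i="\<lambda>A. (A \<inter> B, A - B)" and j="\<lambda>(S, T). S \<union> T"])
    fix z assume "z \<in> {A. A \<subseteq> B \<and> card A = j} \<times> {A. A \<subseteq> I - B \<and> card A = k}"
    then obtain S T where z: "z = (S, T)" "S \<subseteq> B" "T \<subseteq> I - B" "card S = j" "card T = k" by auto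
    then have "(S \<union> T) \<inter> B = S" "(S \<union> T) - B = T" by auto
    with z assms show "((case z of (S, T) \<Rightarrow> S \<union> T) \<inter> B, (case z of (S, T) \<Rightarrow> S \<union> T) - B) = z"
      "(case z of (S, T) \<Rightarrow> S \<union> T) \<in> {A. A \<subseteq> I \<and> card (A \<inter> B) = j \<and> card (A - B) = k}"
      by auto
  qed auto
  finally show ?thesis .
qed

text \<open>The sum is the probability that a random subset of \<open>I\<close>, containing each point independently
  with probability \<open>t\<close>, meets \<open>A\<close> in exactly one point.\<close>
lemma sum_weights_meet_once:
  fixes t :: real
  assumes I: "finite I" and A: "A \<subseteq> I" "card A = Suc m"
  shows "(\<Sum>B\<in>{B\<in>Pow I. card (A \<inter> B) = 1}. t ^ card B * (1 - t) ^ card (I - B)) = Suc m * (t * (1 - t) ^ m)"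
proof -
  define w where "w B = t ^ card B * (1 - t) ^ card (I - B)" for B
  have fA: "finite A" using A I finite_subset by blast
  have one: "(\<Sum>B\<in>{B\<in>Pow I. A \<inter> B = {i}}. w B) = t * (1 - t) ^ m" if i: "i \<in> A" for i
  proof -
    \<comment> \<open>The zeros of \<open>f\<close> and \<open>g\<close> encode the constraint: a
      point of \<open>A - {i}\<close> may not lie in \<open>B\<close>, and \<open>i\<close> may not
      lie outside it. The constrained sum becomes a full sum over \<open>Pow I\<close>, hence a
      product with factor \<open>t\<close> at \<open>i\<close>, \<open>1 - t\<close> on
      \<open>A - {i}\<close> and 1 elsewhere.\<close>
    define f where "f a = (if a \<in> A - {i} then 0 else t)" for a
    define g where "g a = (if a = i then 0 else 1 - t)" for a
    have "(\<Sum>B\<in>{B\<in>Pow I. A \<inter> B = {i}}. w B) = (\<Sum>B\<in>Pow I. prod f B * prod g (I - B))"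
    proof (rule sum.mono_neutral_cong_left)
      show "finite (Pow I)" using I by simp
      show "\<forall>B\<in>Pow I - {B \<in> Pow I. A \<inter> B = {i}}. prod f B * prod g (I - B) = 0"
      proof
        fix B assume B: "B \<in> Pow I - {B \<in> Pow I. A \<inter> B = {i}}"
        then have fB: "finite B" using I finite_subset by blast
        from B have "i \<in> I - B \<or> (\<exists>a\<in>B. a \<in> A - {i})" using i A by auto
        then show "prod f B * prod g (I - B) = 0"
          using fB I by (auto simp: f_def g_def)
      qed
      show "w B = prod f B * prod g (I - B)" if "B \<in> {B \<in> Pow I. A \<inter> B = {i}}" for B
      proof -
        have "prod f B = (\<Prod>a\<in>B. t)" using that by (intro prod.cong) (auto simp: f_def)
        moreover have "prod g (I - B) = (\<Prod>a\<in>I - B. 1 - t)"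
          using that by (intro prod.cong) (auto simp: g_def)
        ultimately show ?thesis by (simp add: w_def)
      qed
    qed auto
    also have "\<dots> = (\<Prod>a\<in>I. f a + g a)" by (rule prod_add[OF I, symmetric])
    also have "\<dots> = (\<Prod>a\<in>A. f a + g a)"
      using I A i by (intro prod.mono_neutral_right) (auto simp: f_def g_def)
    also have "\<dots> = (f i + g i) * (\<Prod>a\<in>A - {i}. f a + g a)" by (rule prod.remove[OF fA i])
    also have "(\<Prod>a\<in>A - {i}. f a + g a) = (\<Prod>a\<in>A - {i}. 1 - t)"
      by (intro prod.cong) (auto simp: f_def g_def)
    finally show ?thesis using A i fA by (simp add: f_def g_def)
  qed
  have "{B\<in>Pow I. card (A \<inter> B) = 1} = (\<Union>i\<in>A. {B\<in>Pow I. A \<inter> B = {i}})"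
    by (auto simp: card_1_singleton_iff)
  then have "(\<Sum>B\<in>{B\<in>Pow I. card (A \<inter> B) = 1}. w B) = (\<Sum>i\<in>A. \<Sum>B\<in>{B\<in>Pow I. A \<inter> B = {i}}. w B)"
    using fA I by (simp only:) (intro sum.UNION_disjoint; auto)
  also have "\<dots> = Suc m * (t * (1 - t) ^ m)" using one A by simp
  finally show ?thesis by (simp add: w_def)
qed

text \<open>Jensen's inequality for finite averages, from the tangents at the weighted mean
  \<open>c\<close>.\<close>

lemma abs_powr_weighted_sum_le:
  fixes w F :: "'b \<Rightarrow> real"
  assumes "1 \<le> p" "\<And>i. i \<in> J \<Longrightarrow> 0 \<le> w i" "(\<Sum>i\<in>J. w i) = 1"
  shows "\<bar>\<Sum>i\<in>J. w i * F i\<bar> powr p \<le> (\<Sum>i\<in>J. w i * \<bar>F i\<bar> powr p)"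
proof -
  define c where "c = (\<Sum>i\<in>J. w i * F i)"
  have "(\<Sum>i\<in>J. w i * (\<bar>c\<bar> powr p + p * signed_powr (p - 1) c * (F i - c))) \<le> (\<Sum>i\<in>J. w i * \<bar>F i\<bar> powr p)"
    using assms by (intro sum_mono mult_left_mono abs_powr_tangent) auto
  also have "(\<Sum>i\<in>J. w i * (\<bar>c\<bar> powr p + p * signed_powr (p - 1) c * (F i - c)))
      = (\<Sum>i\<in>J. w i * (\<bar>c\<bar> powr p - p * signed_powr (p - 1) c * c) + p * signed_powr (p - 1) c * (w i * F i))"
    by (intro sum.cong refl) (simp add: algebra_simps)
  also have "\<dots> = (\<Sum>i\<in>J. w i) * (\<bar>c\<bar> powr p - p * signed_powr (p - 1) c * c) + p * signed_powr (p - 1) c * c"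
    by (simp add: sum.distrib sum_distrib_right[symmetric] sum_distrib_left[symmetric] c_def)
  finally show ?thesis using assms(3) by (simp add: c_def)
qed

section \<open>Operators acting on a block of coordinates\<close>

context hoeffding_cube
begin

text \<open>The level-\<open>k\<close> operator in the variables of \<open>B\<close> alone: keeping
  \<open>coords - B\<close> in each conditional expectation leaves the outer variables frozen. For
  \<open>B = coords\<close> it is \<open>hoeffding_level\<close>.\<close>

definition block_level :: "nat set \<Rightarrow> nat \<Rightarrow> ((nat \<Rightarrow> 'a) \<Rightarrow> real) \<Rightarrow> (nat \<Rightarrow> 'a) \<Rightarrow> real" where
  "block_level B k f x = (\<Sum>A\<in>{A. A \<subseteq> B \<and> card A = k}.
     \<Sum>S\<in>Pow A. (-1) ^ card (A - S) * CE (S \<union> (coords - B)) f x)"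

abbreviation "nmom p f \<equiv> (\<integral>\<^sup>+x. ennreal (\<bar>f x\<bar> powr p) \<partial>P)"

lemma hoeffding_level_eq:
  "hoeffding_level M N k f x = (\<Sum>A\<in>{A. A \<subseteq> coords \<and> card A = k}. hoeffding_proj M N A f x)"
  by (simp add: hoeffding_level_def coords_def)

lemma in_Lp_block_level:
  assumes "in_Lp P p f" "1 \<le> p" "B \<subseteq> coords"
  shows "in_Lp P p (block_level B k f)"
  unfolding block_level_def[abs_def]
  using assms by (intro in_Lp_sum in_Lp_cmult in_Lp_cond_exp) auto

text \<open>The section of \<open>f\<close> over \<open>x\<close> ignores the coordinates outside
  \<open>B\<close>, so of the full level only the projections with \<open>A\<close> inside
  \<open>B\<close> survive; the others vanish by \<open>sum_Pow_alternating_eq_0\<close>.\<close>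

lemma block_level_glue:
  assumes B: "B \<subseteq> coords" and xy: "x \<in> space P" "y \<in> space P" and [measurable]: "f \<in> borel_measurable P"
  shows "block_level B k f (glue (coords - B) x y) = hoeffding_level M N k (\<lambda>z. f (glue (coords - B) x z)) y"
proof -
  define g where "g z = f (glue (coords - B) x z)" for z
  have Bc: "coords - B \<subseteq> coords" by auto
  have [measurable]: "g \<in> borel_measurable P"
    unfolding g_def by (rule measurable_compose[OF measurable_glue_right[OF Bc xy(1)]]) simp
  have in_B: "CE S g y = CE (S \<union> (coords - B)) f (glue (coords - B) x y)" if S: "S \<subseteq> B" for S
  proof -
    have "glue (coords - B) x (glue S y z) = glue (S \<union> (coords - B)) (glue (coords - B) x y) z" for z
      using S B by (auto simp: fun_eq_iff glue_apply)
    moreover have "S \<subseteq> coords" "S \<union> (coords - B) \<subseteq> coords" using S B by auto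
    ultimately show ?thesis
      using xy Bc by (simp add: cond_exp_eq_glue glue_in_space g_def[symmetric]) (simp add: g_def)
  qed
  have off_B: "CE (insert i S) g y = CE S g y" if i: "i \<in> coords - B" and S: "S \<subseteq> coords" for i S
  proof -
    have "glue (coords - B) x (glue (insert i S) y z) = glue (coords - B) x (glue S y z)" for z
      using i by (auto simp: fun_eq_iff glue_apply)
    moreover have "insert i S \<subseteq> coords" using S i by auto
    ultimately show ?thesis using xy S by (simp add: cond_exp_eq_glue) (simp add: g_def)
  qed
  have "hoeffding_level M N k g y = (\<Sum>A\<in>{A. A \<subseteq> B \<and> card A = k}. hoeffding_proj M N A g y)"
    unfolding hoeffding_level_eq
  proof (rule sum.mono_neutral_right)
    show "\<forall>A\<in>{A. A \<subseteq> coords \<and> card A = k} - {A. A \<subseteq> B \<and> card A = k}. hoeffding_proj M N A g y = 0"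
    proof
      fix A assume A: "A \<in> {A. A \<subseteq> coords \<and> card A = k} - {A. A \<subseteq> B \<and> card A = k}"
      then obtain i where i: "i \<in> A" "i \<in> coords - B" by auto
      have "finite A" using A finite_subset[OF _ finite_coords] by auto
      then show "hoeffding_proj M N A g y = 0"
        unfolding hoeffding_proj_def using A i(1) off_B[OF i(2)]
        by (intro sum_Pow_alternating_eq_0[OF _ i(1)]) auto
    qed
  qed (use B in auto)
  also have "\<dots> = block_level B k f (glue (coords - B) x y)"
    unfolding block_level_def hoeffding_proj_def
    by (intro sum.cong refl arg_cong2[where f="(*)"] in_B) auto
  finally show ?thesis by (simp add: g_def[abs_def])
qed

text \<open>Freezing the coordinates outside \<open>B\<close>, a block operator is the full operator applied to a
  function that ignores those coordinates, so by Fubini its norm is no larger.\<close>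
lemma nmom_block_level_le:
  assumes D: "\<And>f. in_Lp P p f \<Longrightarrow> nmom p (hoeffding_level M N k f) \<le> ennreal D * nmom p f"
    and f: "in_Lp P p f" and B: "B \<subseteq> coords" and p: "1 \<le> p"
  shows "nmom p (block_level B k f) \<le> ennreal D * nmom p f"
proof -
  let ?Bc = "coords - B"
  have Bc: "?Bc \<subseteq> coords" by auto
  have [measurable]: "f \<in> borel_measurable P" "block_level B k f \<in> borel_measurable P"
    using in_Lp_block_level[OF f p B] f by auto
  have "nmom p (block_level B k f) = (\<integral>\<^sup>+x. \<integral>\<^sup>+y. ennreal (\<bar>block_level B k f (glue ?Bc x y)\<bar> powr p) \<partial>P \<partial>P)"
    by (rule nn_integral_comp_glue[OF Bc, symmetric]) measurable
  also have "\<dots> \<le> (\<integral>\<^sup>+x. ennreal D * (\<integral>\<^sup>+y. ennreal (\<bar>f (glue ?Bc x y)\<bar> powr p) \<partial>P) \<partial>P)"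
  proof (rule nn_integral_mono_AE)
    have "integrable P (\<lambda>x. \<bar>f x\<bar> powr p)" using f by (simp add: in_Lp_def)
    from AE_integrable_glue[OF Bc this] AE_space
    show "AE x in P. (\<integral>\<^sup>+y. ennreal (\<bar>block_level B k f (glue ?Bc x y)\<bar> powr p) \<partial>P)
        \<le> ennreal D * (\<integral>\<^sup>+y. ennreal (\<bar>f (glue ?Bc x y)\<bar> powr p) \<partial>P)"
    proof eventually_elim
      case (elim x)
      have "(\<lambda>y. f (glue ?Bc x y)) \<in> borel_measurable P"
        by (rule measurable_compose[OF measurable_glue_right[OF Bc elim(2)]]) simp
      then have "in_Lp P p (\<lambda>y. f (glue ?Bc x y))" using elim by (simp add: in_Lp_def)
      from D[OF this] show ?case
        using elim by (simp add: block_level_glue[OF B] cong: nn_integral_cong)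
    qed
  qed
  also have "\<dots> = ennreal D * (\<integral>\<^sup>+x. \<integral>\<^sup>+y. ennreal (\<bar>f (glue ?Bc x y)\<bar> powr p) \<partial>P \<partial>P)"
  proof (rule nn_integral_cmult)
    have "(\<lambda>z. ennreal (\<bar>f (glue ?Bc (fst z) (snd z))\<bar> powr p)) \<in> borel_measurable (P \<Otimes>\<^sub>M P)"
      using measurable_comp_glue[OF Bc \<open>f \<in> _\<close>] by measurable
    from cube.borel_measurable_nn_integral_fst[OF this]
    show "(\<lambda>x. \<integral>\<^sup>+y. ennreal (\<bar>f (glue ?Bc x y)\<bar> powr p) \<partial>P) \<in> borel_measurable P" by simp
  qed
  also have "(\<integral>\<^sup>+x. \<integral>\<^sup>+y. ennreal (\<bar>f (glue ?Bc x y)\<bar> powr p) \<partial>P \<partial>P) = nmom p f"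
    by (rule nn_integral_comp_glue[OF Bc]) measurable
  finally show ?thesis .
qed

text \<open>By the tower property, conditioning on \<open>S \<union> (coords - B)\<close> and on
  \<open>T \<union> B\<close> amounts to conditioning on \<open>S \<union> T\<close>, so the two
  alternating sums merge into one over the subsets of \<open>A1 \<union> A2\<close>.\<close>

lemma block_level_comp:
  assumes f: "integrable P f" and B: "B \<subseteq> coords"
  shows "AE x in P. block_level B j (block_level (coords - B) k f) x
    = (\<Sum>A\<in>{A. A \<subseteq> coords \<and> card (A \<inter> B) = j \<and> card (A - B) = k}. hoeffding_proj M N A f x)"
proof -
  define J1 where "J1 = {A. A \<subseteq> B \<and> card A = j}"
  define J2 where "J2 = {A. A \<subseteq> coords - B \<and> card A = k}"
  have fin: "finite B" "finite J1" "finite J2"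
    using finite_subset[OF B] by (auto simp: J1_def J2_def)
  define Q where "Q = Sigma J2 Pow"
  have fin2: "finite A" if "A \<in> J2" for A
    using that finite_subset[of A coords] by (auto simp: J2_def)
  have fin1: "finite A" if "A \<in> J1" for A
    using that finite_subset[of A B] fin by (auto simp: J1_def)
  have fQ: "finite Q" using fin fin2 by (auto simp: Q_def)
  define c where "c = (\<lambda>(A, S :: nat set). (-1 :: real) ^ card (A - S))"
  define h where "h = (\<lambda>(A :: nat set, S). CE (S \<union> B) f)"
  have inner: "block_level (coords - B) k f = (\<lambda>x. \<Sum>q\<in>Q. c q * h q x)"
  proof
    fix x
    have "coords - (coords - B) = B" using B by auto
    then have "block_level (coords - B) k f x = (\<Sum>A\<in>J2. \<Sum>S\<in>Pow A. c (A, S) * h (A, S) x)"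
      by (simp add: block_level_def J2_def c_def h_def)
    also have "\<dots> = (\<Sum>q\<in>Q. c q * h q x)"
      unfolding Q_def using fin fin2 by (subst sum.Sigma) (auto simp: case_prod_unfold)
    finally show "block_level (coords - B) k f x = (\<Sum>q\<in>Q. c q * h q x)" .
  qed
  have hint: "integrable P (h q)" if "q \<in> Q" for q
    using that f B by (auto simp: Q_def J2_def h_def intro!: integrable_cond_exp)
  have "AE x in P. \<forall>S\<in>Pow B. CE (S \<union> (coords - B)) (block_level (coords - B) k f) x
      = (\<Sum>q\<in>Q. c q * CE (S \<union> (coords - B)) (h q) x)"
    unfolding inner using fin fQ B hint by (intro AE_finite_allI cond_exp_sum) auto
  moreover have "AE x in P. \<forall>S\<in>Pow B. \<forall>T\<in>Pow (coords - B).
      CE (S \<union> (coords - B)) (CE (T \<union> B) f) x = CE (S \<union> T) f x"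
  proof (intro AE_finite_allI)
    fix S T assume ST: "S \<in> Pow B" "T \<in> Pow (coords - B)"
    then have "(S \<union> (coords - B)) \<inter> (T \<union> B) = S \<union> T" by auto
    then show "AE x in P. CE (S \<union> (coords - B)) (CE (T \<union> B) f) x = CE (S \<union> T) f x"
      using cond_exp_tower[of "S \<union> (coords - B)" "T \<union> B" f] ST B f by auto
  qed (use fin in auto)
  ultimately show ?thesis
  proof eventually_elim
    case (elim x)
    have "block_level B j (block_level (coords - B) k f) x
        = (\<Sum>A1\<in>J1. \<Sum>S\<in>Pow A1. (-1) ^ card (A1 - S) * (\<Sum>q\<in>Q. c q * CE (S \<union> (coords - B)) (h q) x))"
      unfolding block_level_def[of B] J1_def[symmetric]
      using elim(1) by (intro sum.cong refl arg_cong2[where f="(*)"]) (auto simp: J1_def)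
    also have "\<dots> = (\<Sum>A1\<in>J1. \<Sum>S\<in>Pow A1. (-1) ^ card (A1 - S) *
        (\<Sum>A2\<in>J2. \<Sum>T\<in>Pow A2. (-1) ^ card (A2 - T) * CE (S \<union> T) f x))"
    proof (intro sum.cong refl arg_cong2[where f="(*)"])
      fix A1 S assume S: "A1 \<in> J1" "S \<in> Pow A1"
      have "(\<Sum>q\<in>Q. c q * CE (S \<union> (coords - B)) (h q) x)
          = (\<Sum>A2\<in>J2. \<Sum>T\<in>Pow A2. c (A2, T) * CE (S \<union> (coords - B)) (h (A2, T)) x)"
        unfolding Q_def using fin fin2 by (subst sum.Sigma) (auto simp: case_prod_unfold)
      also have "\<dots> = (\<Sum>A2\<in>J2. \<Sum>T\<in>Pow A2. (-1) ^ card (A2 - T) * CE (S \<union> T) f x)"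
      proof (intro sum.cong refl)
        fix A2 T assume T: "A2 \<in> J2" "T \<in> Pow A2"
        have "S \<in> Pow B" "T \<in> Pow (coords - B)" using S T by (auto simp: J1_def J2_def)
        then show "c (A2, T) * CE (S \<union> (coords - B)) (h (A2, T)) x = (-1) ^ card (A2 - T) * CE (S \<union> T) f x"
          using elim(2) by (simp add: c_def h_def)
      qed
      finally show "(\<Sum>q\<in>Q. c q * CE (S \<union> (coords - B)) (h q) x)
          = (\<Sum>A2\<in>J2. \<Sum>T\<in>Pow A2. (-1) ^ card (A2 - T) * CE (S \<union> T) f x)" .
    qed
    also have "\<dots> = (\<Sum>A1\<in>J1. \<Sum>A2\<in>J2. \<Sum>S\<in>Pow A1. \<Sum>T\<in>Pow A2.
        (-1) ^ card (A1 - S) * ((-1) ^ card (A2 - T) * CE (S \<union> T) f x))"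
      unfolding sum_distrib_left by (intro sum.cong refl sum.swap)
    also have "\<dots> = (\<Sum>A1\<in>J1. \<Sum>A2\<in>J2. hoeffding_proj M N (A1 \<union> A2) f x)"
    proof (intro sum.cong refl)
      fix A1 A2 assume A: "A1 \<in> J1" "A2 \<in> J2"
      have "A1 \<inter> A2 = {}" using A by (auto simp: J1_def J2_def)
      then show "(\<Sum>S\<in>Pow A1. \<Sum>T\<in>Pow A2. (-1) ^ card (A1 - S) * ((-1) ^ card (A2 - T) * CE (S \<union> T) f x))
          = hoeffding_proj M N (A1 \<union> A2) f x"
        unfolding hoeffding_proj_def using sum_Pow_alternating_Un[of A1 A2 "\<lambda>S. CE S f x"] fin1 fin2 A
        by simp
    qed
    also have "\<dots> = (\<Sum>A\<in>{A. A \<subseteq> coords \<and> card (A \<inter> B) = j \<and> card (A - B) = k}. hoeffding_proj M N A f x)"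
      unfolding J1_def J2_def by (rule sum_subsets_split[OF finite_coords B])
    finally show ?case .
  qed
qed

text \<open>After exchanging the sums, each \<open>A\<close> collects the weights of the blocks
  meeting it exactly once, and by \<open>sum_weights_meet_once\<close> this total is the same for
  all \<open>A\<close> of size \<open>Suc m\<close>.\<close>

lemma average_blocks:
  fixes t :: real and H :: "nat set \<Rightarrow> real"
  shows "(\<Sum>B\<in>Pow coords. (t ^ card B * (1 - t) ^ card (coords - B)) *
      (\<Sum>A\<in>{A. A \<subseteq> coords \<and> card (A \<inter> B) = 1 \<and> card (A - B) = m}. H A))
    = Suc m * (t * (1 - t) ^ m) * (\<Sum>A\<in>{A. A \<subseteq> coords \<and> card A = Suc m}. H A)"
proof -
  define w where "w B = t ^ card B * (1 - t) ^ card (coords - B)" for B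
  define L where "L = {A. A \<subseteq> coords \<and> card A = Suc m}"
  have fL: "finite L" by (auto simp: L_def)
  have eq: "{A. A \<subseteq> coords \<and> card (A \<inter> B) = 1 \<and> card (A - B) = m} = {A\<in>L. card (A \<inter> B) = 1}" for B
  proof -
    have "card A = card (A \<inter> B) + card (A - B)" if "A \<subseteq> coords" for A
      using card_Int_Diff[of A B] finite_subset[OF that] by simp
    then show ?thesis by (auto simp: L_def)
  qed
  have "(\<Sum>B\<in>Pow coords. w B * (\<Sum>A\<in>{A. A \<subseteq> coords \<and> card (A \<inter> B) = 1 \<and> card (A - B) = m}. H A))
      = (\<Sum>B\<in>Pow coords. \<Sum>A\<in>{A\<in>L. card (A \<inter> B) = 1}. w B * H A)"
    unfolding eq sum_distrib_left ..
  also have "\<dots> = (\<Sum>A\<in>L. \<Sum>B\<in>{B\<in>Pow coords. card (A \<inter> B) = 1}. w B * H A)"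
    by (rule sum.swap_restrict) (auto simp: fL)
  also have "\<dots> = (\<Sum>A\<in>L. Suc m * (t * (1 - t) ^ m) * H A)"
    unfolding sum_distrib_right[symmetric] w_def
    by (intro sum.cong refl arg_cong2[where f="(*)"] sum_weights_meet_once) (auto simp: L_def)
  finally show ?thesis by (simp add: w_def L_def sum_distrib_left)
qed

text \<open>Each composition of two block operators costs the factors \<open>D1\<close> and
  \<open>D2\<close>. The next level is a rescaled average of these compositions, and the rescaling
  costs at most \<open>exp 1\<close> in norm.\<close>

lemma nmom_level_Suc_le:
  assumes p: "1 \<le> p" and m: "1 \<le> m"
    and D1: "\<And>f. in_Lp P p f \<Longrightarrow> nmom p (hoeffding_level M N 1 f) \<le> ennreal D1 * nmom p f"
    and D2: "\<And>f. in_Lp P p f \<Longrightarrow> nmom p (hoeffding_level M N m f) \<le> ennreal D2 * nmom p f"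
    and f: "in_Lp P p f"
  shows "nmom p (hoeffding_level M N (Suc m) f) \<le> ennreal (exp 1 powr p) * (ennreal D1 * (ennreal D2 * nmom p f))"
proof -
  \<comment> \<open>This value maximises the averaging factor
    \<open>Suc m * (t * (1 - t) ^ m)\<close> and reduces it to \<open>(1 - t) ^ m\<close>.\<close>
  define t where "t = 1 / real (Suc m)"
  have t: "0 < t" "t < 1" "Suc m * t = 1" using m by (auto simp: t_def)
  define w where "w B = t ^ card B * (1 - t) ^ card (coords - B)" for B
  have w0: "0 \<le> w B" for B using t by (simp add: w_def)
  have "(\<Sum>B\<in>Pow coords. (\<Prod>b\<in>B. t) * (\<Prod>b\<in>coords - B. 1 - t)) = (\<Prod>b\<in>coords. t + (1 - t))"
    by (rule prod_add[OF finite_coords, symmetric])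
  then have w1: "(\<Sum>B\<in>Pow coords. w B) = 1" by (simp add: w_def)
  define F where "F B = block_level B 1 (block_level (coords - B) m f)" for B
  have Bc: "coords - B \<subseteq> coords" for B by auto
  have inner: "in_Lp P p (block_level (coords - B) m f)" for B
    by (rule in_Lp_block_level[OF f p Bc])
  have F: "in_Lp P p (F B)" if "B \<subseteq> coords" for B
    unfolding F_def by (rule in_Lp_block_level[OF inner p that])
  have Fle: "nmom p (F B) \<le> ennreal D1 * (ennreal D2 * nmom p f)" if "B \<subseteq> coords" for B
  proof -
    have "nmom p (F B) \<le> ennreal D1 * nmom p (block_level (coords - B) m f)"
      unfolding F_def by (rule nmom_block_level_le[OF D1 inner that p])
    also have "\<dots> \<le> ennreal D1 * (ennreal D2 * nmom p f)"
      by (intro mult_left_mono nmom_block_level_le[OF D2 f Bc p]) auto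
    finally show ?thesis .
  qed
  \<comment> \<open>The loss in the averaging is exactly \<open>(1 + 1 / m) ^ m\<close>.\<close>
  have e: "1 / (1 - t) ^ m \<le> exp 1"
  proof -
    have "1 / (1 - t) = 1 + 1 / real m" using m by (simp add: t_def field_simps)
    then have "1 / (1 - t) ^ m = (1 + 1 / real m) ^ m" by (metis power_one_over)
    also have "\<dots> \<le> exp (1 / real m) ^ m" by (intro power_mono exp_ge_add_one_self) auto
    also have "\<dots> = exp 1" using m by (simp add: exp_of_nat_mult[symmetric])
    finally show ?thesis .
  qed
  have "AE x in P. \<forall>B\<in>Pow coords. F B x
      = (\<Sum>A\<in>{A. A \<subseteq> coords \<and> card (A \<inter> B) = 1 \<and> card (A - B) = m}. hoeffding_proj M N A f x)"
    unfolding F_def using cube.in_Lp_integrable[OF f p]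
    by (intro AE_finite_allI block_level_comp) auto
  then have "AE x in P. ennreal (\<bar>hoeffding_level M N (Suc m) f x\<bar> powr p)
      \<le> ennreal (exp 1 powr p) * (\<Sum>B\<in>Pow coords. ennreal (w B) * ennreal (\<bar>F B x\<bar> powr p))"
  proof eventually_elim
    case (elim x)
    have "(\<Sum>B\<in>Pow coords. w B * F B x) = (\<Sum>B\<in>Pow coords. (t ^ card B * (1 - t) ^ card (coords - B)) *
        (\<Sum>A\<in>{A. A \<subseteq> coords \<and> card (A \<inter> B) = 1 \<and> card (A - B) = m}. hoeffding_proj M N A f x))"
      using elim by (intro sum.cong) (auto simp: w_def)
    also have "\<dots> = Suc m * (t * (1 - t) ^ m) * hoeffding_level M N (Suc m) f x"
      unfolding hoeffding_level_eq by (rule average_blocks)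
    also have "\<dots> = (1 - t) ^ m * hoeffding_level M N (Suc m) f x"
      unfolding mult.assoc[symmetric] t(3) by simp
    finally have "hoeffding_level M N (Suc m) f x = 1 / (1 - t) ^ m * (\<Sum>B\<in>Pow coords. w B * F B x)"
      using t by simp
    then have "\<bar>hoeffding_level M N (Suc m) f x\<bar> \<le> exp 1 * \<bar>\<Sum>B\<in>Pow coords. w B * F B x\<bar>"
      using mult_right_mono[OF e abs_ge_zero[of "\<Sum>B\<in>Pow coords. w B * F B x"]] t by (simp add: abs_mult)
    then have "\<bar>hoeffding_level M N (Suc m) f x\<bar> powr p \<le> (exp 1 * \<bar>\<Sum>B\<in>Pow coords. w B * F B x\<bar>) powr p"
      using p by (intro powr_mono2) auto
    also have "\<dots> = exp 1 powr p * \<bar>\<Sum>B\<in>Pow coords. w B * F B x\<bar> powr p" by (simp add: powr_mult)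
    also have "\<dots> \<le> exp 1 powr p * (\<Sum>B\<in>Pow coords. w B * \<bar>F B x\<bar> powr p)"
      by (intro mult_left_mono abs_powr_weighted_sum_le p w0 w1) auto
    finally have "ennreal (\<bar>hoeffding_level M N (Suc m) f x\<bar> powr p)
        \<le> ennreal (exp 1 powr p * (\<Sum>B\<in>Pow coords. w B * \<bar>F B x\<bar> powr p))" by (rule ennreal_leI)
    also have "\<dots> = ennreal (exp 1 powr p) * (\<Sum>B\<in>Pow coords. ennreal (w B) * ennreal (\<bar>F B x\<bar> powr p))"
      using w0 by (simp add: ennreal_mult sum_nonneg flip: sum_ennreal)
    finally show ?case .
  qed
  then have "nmom p (hoeffding_level M N (Suc m) f)
      \<le> (\<integral>\<^sup>+x. ennreal (exp 1 powr p) * (\<Sum>B\<in>Pow coords. ennreal (w B) * ennreal (\<bar>F B x\<bar> powr p)) \<partial>P)"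
    by (rule nn_integral_mono_AE)
  also have "\<dots> = ennreal (exp 1 powr p) * (\<Sum>B\<in>Pow coords. ennreal (w B) * nmom p (F B))"
  proof -
    have [measurable]: "F B \<in> borel_measurable P" if "B \<in> Pow coords" for B using F[of B] that by auto
    show ?thesis by (simp add: nn_integral_cmult nn_integral_sum)
  qed
  also have "\<dots> \<le> ennreal (exp 1 powr p) *
      (\<Sum>B\<in>Pow coords. ennreal (w B) * (ennreal D1 * (ennreal D2 * nmom p f)))"
    using Fle by (intro mult_left_mono sum_mono) auto
  also have "(\<Sum>B\<in>Pow coords. ennreal (w B) * (ennreal D1 * (ennreal D2 * nmom p f)))
      = ennreal (\<Sum>B\<in>Pow coords. w B) * (ennreal D1 * (ennreal D2 * nmom p f))"
    using w0 by (simp add: sum_distrib_right flip: sum_ennreal)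
  finally show ?thesis by (simp add: w1)
qed

text \<open>Level \<open>Suc m\<close> is reached from level 1 by \<open>m\<close> averaging steps,
  hence \<open>m\<close> factors \<open>exp 1\<close> against \<open>Suc m\<close> factors
  \<open>k\<close>.\<close>

lemma nmom_level_le:
  assumes p: "1 \<le> p" and k: "0 \<le> k"
    and D1: "\<And>f. in_Lp P p f \<Longrightarrow> nmom p (hoeffding_level M N 1 f) \<le> ennreal (k powr p) * nmom p f"
    and f: "in_Lp P p f"
  shows "nmom p (hoeffding_level M N (Suc m) f) \<le> ennreal ((exp 1 ^ m * k ^ Suc m) powr p) * nmom p f"
  using f
proof (induction m arbitrary: f)
  case 0
  then show ?case using D1 by simp
next
  case (Suc m)
  have "nmom p (hoeffding_level M N (Suc (Suc m)) f)
      \<le> ennreal (exp 1 powr p) * (ennreal (k powr p) * (ennreal ((exp 1 ^ m * k ^ Suc m) powr p) * nmom p f))"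
    by (rule nmom_level_Suc_le[OF p _ D1 Suc.IH Suc.prems]) auto
  also have "\<dots> = ennreal ((exp 1 * (k * (exp 1 ^ m * k ^ Suc m))) powr p) * nmom p f"
    using k by (simp add: powr_mult ennreal_mult mult.assoc)
  finally show ?case by (simp add: algebra_simps)
qed

end

section \<open>Operator norms and the final estimate\<close>

lemma Lp_op_norm_lessD:
  assumes "Lp_op_norm M p T < ennreal k" "0 < p" "in_Lp M p f"
  shows "(\<integral>\<^sup>+ x. ennreal (\<bar>T f x\<bar> powr p) \<partial>M) \<le> ennreal (k powr p) * (\<integral>\<^sup>+ x. ennreal (\<bar>f x\<bar> powr p) \<partial>M)"
proof -
  \<comment> \<open>Strictness provides an admissible constant below \<open>k\<close>, so whether
    the infimum is attained is never at issue.\<close>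
  from assms(1) obtain C where C: "ennreal C < ennreal k" "0 \<le> C"
    "(\<integral>\<^sup>+ x. ennreal (\<bar>T f x\<bar> powr p) \<partial>M) \<le> ennreal (C powr p) * (\<integral>\<^sup>+ x. ennreal (\<bar>f x\<bar> powr p) \<partial>M)"
    unfolding Lp_op_norm_def Inf_less_iff using assms(3) by auto
  note C(3)
  also have "ennreal (C powr p) * (\<integral>\<^sup>+ x. ennreal (\<bar>f x\<bar> powr p) \<partial>M)
      \<le> ennreal (k powr p) * (\<integral>\<^sup>+ x. ennreal (\<bar>f x\<bar> powr p) \<partial>M)"
    using C(1,2) assms(2) by (intro mult_right_mono ennreal_leI powr_mono2) (auto simp: ennreal_less_iff)
  finally show ?thesis .
qed

lemma Lp_op_norm_leI:
  assumes "0 \<le> C" "\<And>f. in_Lp M p f \<Longrightarrow>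
    (\<integral>\<^sup>+ x. ennreal (\<bar>T f x\<bar> powr p) \<partial>M) \<le> ennreal (C powr p) * (\<integral>\<^sup>+ x. ennreal (\<bar>f x\<bar> powr p) \<partial>M)"
  shows "Lp_op_norm M p T \<le> ennreal C"
  unfolding Lp_op_norm_def by (rule Inf_lower) (use assms in auto)

theorem theorem3p1:
  fixes M :: "'a measure" and p :: real
  assumes "prob_space M" and "1 < p"
  defines "K \<equiv> (SUP N. Lp_op_norm (cube M N) p (hoeffding_level M N 1))"
  shows "K < \<infinity> \<and>
    (\<forall>m::nat. m \<ge> 1 \<longrightarrow>
       (SUP N. Lp_op_norm (cube M N) p (hoeffding_level M N m))
         \<le> ennreal (1 / exp 1) * (ennreal (exp 1) * K) ^ m)"
proof (intro conjI allI impI)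
  obtain C where C: "0 \<le> C" "\<And>N f. in_Lp (cube M N) p f \<Longrightarrow>
      (\<integral>x. \<bar>hoeffding_level M N 1 f x\<bar> powr p \<partial>cube M N) \<le> C * (\<integral>x. \<bar>f x\<bar> powr p \<partial>cube M N)"
    using level1_bounded[OF assms(1,2)] by blast
  \<comment> \<open>The p-th root appears because moment inequalities carry the p-th power of the
    norm.\<close>
  have "K \<le> ennreal (C powr (1 / p))"
    unfolding K_def
  proof (intro SUP_least Lp_op_norm_leI)
    fix N f assume f: "in_Lp (cube M N) p f"
    interpret hoeffding_cube M N using assms(1) by (simp add: hoeffding_cube_def)
    have "in_Lp P p (hoeffding_level M N 1 f)" using assms(2) by (intro in_Lp_level1 f) auto
    then have "nmom p (hoeffding_level M N 1 f) = ennreal (mom p (hoeffding_level M N 1 f))"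
      by (intro nn_integral_eq_integral) (auto simp: in_Lp_def)
    also have "\<dots> \<le> ennreal (C * mom p f)" by (intro ennreal_leI C f)
    also have "\<dots> = ennreal C * ennreal (mom p f)" using C by (simp add: ennreal_mult)
    also have "ennreal (mom p f) = nmom p f"
      using f by (intro nn_integral_eq_integral[symmetric]) (auto simp: in_Lp_def)
    also have "C = (C powr (1 / p)) powr p" using C(1) assms(2) by (simp add: powr_powr)
    finally show "nmom p (hoeffding_level M N 1 f) \<le> ennreal ((C powr (1 / p)) powr p) * nmom p f" .
  qed simp
  then show K: "K < \<infinity>" by (simp add: le_less_trans)
  fix m :: nat assume "1 \<le> m"
  then obtain n where m: "m = Suc n" by (cases m) auto
  define k where "k = enn2real K"
  have k: "0 \<le> k" "K = ennreal k" using K by (auto simp: k_def)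
  define s where "s = (SUP N. Lp_op_norm (cube M N) p (hoeffding_level M N m))"
  \<comment> \<open>Taking \<open>l\<close> strictly above \<open>k\<close> makes
    \<open>Lp_op_norm_lessD\<close> applicable for every \<open>N\<close>; the claim follows by
    letting \<open>l\<close> decrease to \<open>k\<close>.\<close>
  have "s \<le> ennreal (exp 1 ^ n * l ^ m)" if l: "k < l" for l
    unfolding s_def
  proof (intro SUP_least Lp_op_norm_leI)
    fix N f assume f: "in_Lp (cube M N) p f"
    interpret hoeffding_cube M N using assms(1) by (simp add: hoeffding_cube_def)
    have "Lp_op_norm P p (hoeffding_level M N 1) \<le> K" unfolding K_def by (rule SUP_upper) simp
    also have "K < ennreal l" using k l by (simp add: ennreal_less_iff)
    finally have "Lp_op_norm P p (hoeffding_level M N 1) < ennreal l" .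
    from Lp_op_norm_lessD[OF this] assms(2) k l f
    show "nmom p (hoeffding_level M N m f) \<le> ennreal ((exp 1 ^ n * l ^ m) powr p) * nmom p f"
      unfolding m by (intro nmom_level_le) auto
  qed (use k l in auto)
  then have "\<forall>\<^sub>F l in at_right k. s \<le> ennreal (exp 1 ^ n * l ^ m)"
    by (intro eventually_at_rightI[of k "k + 1"]) auto
  moreover have "((\<lambda>l. ennreal (exp 1 ^ n * l ^ m)) \<longlongrightarrow> ennreal (exp 1 ^ n * k ^ m)) (at_right k)"
    by (intro tendsto_ennrealI tendsto_intros)
  ultimately have "s \<le> ennreal (exp 1 ^ n * k ^ m)"
    by (intro tendsto_lowerbound[where F="at_right k"]) auto
  \<comment> \<open>As \<open>m = Suc n\<close>, there is one factor \<open>exp 1\<close> fewer than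
    factors \<open>k\<close>, whence \<open>1 / exp 1\<close>.\<close>
  also have "exp 1 ^ n * k ^ m = 1 / exp 1 * (exp 1 * k) ^ m"
    by (simp add: m power_mult_distrib)
  also have "ennreal \<dots> = ennreal (1 / exp 1) * (ennreal (exp 1) * K) ^ m"
    unfolding k(2) using k(1)
    by (subst ennreal_mult) (auto simp: ennreal_mult ennreal_power[symmetric])
  finally show "(SUP N. Lp_op_norm (cube M N) p (hoeffding_level M N m))
      \<le> ennreal (1 / exp 1) * (ennreal (exp 1) * K) ^ m" by (simp add: s_def)
qed

end
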